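(* The Rado algebra $Q$ is totally incoherent (and in particular, not Noetherian). It satisfies the double annihilator condition, but is not self-injective. The reduced quotient is $Q/\sqrt{0}=\mathbb{F}$, where $\mathbb{F}=\mathbb{Z}/2$.
   Context: Rings are $\mathbb{Z}$-graded, unital and commutative; modules are graded; ``element'' and ``ideal'' mean homogeneous element and homogeneous ideal. $\mathbb{N}=\{0,1,2,\dotsc\}$. Let $\mathbb{F}=\mathbb{Z}/2$ and $E=\mathbb{F}[x_0,x_1,\dotsc]/(x_i^2\mid i\geq 0)$ with $|x_i|=2^i$. For $n\in\mathbb{N}$ let $B(n)$ be the unique finite subset of $\mathbb{N}$ with $n=\sum_{i\in B(n)}2^i$. The Rado graph has vertex set $\mathbb{N}$, with an edge from $i$ to $j$ if $i\in B(j)$ or $j\in B(i)$. The Rado ideal in $E$ has a generator $x_ix_j$ for each pair $(i,j)$ such that there is no edge from $i$ to $j$ in the Rado graph. The Rado algebra $Q$ is the quotient of $E$ by the Rado ideal, with the induced grading. A graded ring $R$ is self-injective if it is an injective object in the category of graded $R$-modules. A module $M$ is finitely presented if there is an exact sequence $P_1\to P_0\to M\to 0$ with $P_0,P_1$ finitely generated free, i.e. of the form $\bigoplus_{i=1}^r\Sigma^{d_i}R$. $R$ is totally incoherent if the only finitely presented ideals are $0$ and $R$. For an ideal $J$, $\operatorname{ann}_R(J)=\{a\in R\mid aJ=0\}$ and $\operatorname{ann}_R^2(J)=\operatorname{ann}_R(\operatorname{ann}_R(J))$; $R$ satisfies the double annihilator condition if $\operatorname{ann}_R^2(J)=J$ for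 all finitely generated ideals $J$. $\sqrt{0}$ is the ideal of nilpotent elements. *)

theory Defs
  imports
    "HOL-Algebra.Algebra"
    "HOL-Algebra.Algebraic_Closure_Type"
    "HOL-Library.Poly_Mapping"
    "HOL-Library.Z2"
    "HOL-Library.Infinite_Typeclass"
    "HOL-Library.Nat_Bijection"
begin

section \<open>Graded rings and modules\<close>

text \<open>
  A grading is a family of additive subgroups, indexed by the integers, of which the carrier is the
  internal direct sum. It is kept separate from the record of operations. Only the additive part of
  the record is used, so the same definition serves for rings and for modules.
\<close>

definition graded_by :: "('a, 'c) ring_scheme \<Rightarrow> (int \<Rightarrow> 'a set) \<Rightarrow> bool" where
  "graded_by M G \<longleftrightarrow>
     (\<forall>n. additive_subgroup (G n) M) \<and>
     (\<forall>x\<in>carrier M. \<exists>!c. (\<forall>n. c n \<in> G n) \<and> finite {n. c n \<noteq> \<zero>\<^bsub>M\<^esub>} \<and>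
        x = finsum M c {n. c n \<noteq> \<zero>\<^bsub>M\<^esub>})"

definition graded_ring :: "('a, 'c) ring_scheme \<Rightarrow> (int \<Rightarrow> 'a set) \<Rightarrow> bool" where
  "graded_ring R G \<longleftrightarrow> cring R \<and> graded_by R G \<and> \<one>\<^bsub>R\<^esub> \<in> G 0 \<and>
     (\<forall>m n. \<forall>a\<in>G m. \<forall>b\<in>G n. a \<otimes>\<^bsub>R\<^esub> b \<in> G (m + n))"

definition graded_module ::
  "('a, 'c) ring_scheme \<Rightarrow> (int \<Rightarrow> 'a set) \<Rightarrow> ('a, 'b, 'd) module_scheme \<Rightarrow> (int \<Rightarrow> 'b set) \<Rightarrow> bool"
  where
  "graded_module R G M H \<longleftrightarrow> graded_ring R G \<and> module R M \<and> graded_by M H \<and>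
     (\<forall>m n. \<forall>a\<in>G m. \<forall>x\<in>H n. a \<odot>\<^bsub>M\<^esub> x \<in> H (m + n))"

text \<open>The morphisms of graded modules are the degree-preserving linear maps.\<close>

definition graded_hom ::
  "('a, 'c) ring_scheme \<Rightarrow> ('a, 'b, 'd) module_scheme \<Rightarrow> (int \<Rightarrow> 'b set) \<Rightarrow>
   ('a, 'e, 'f) module_scheme \<Rightarrow> (int \<Rightarrow> 'e set) \<Rightarrow> ('b \<Rightarrow> 'e) set" where
  "graded_hom R M H N K = {h \<in> carrier M \<rightarrow> carrier N.
     (\<forall>x\<in>carrier M. \<forall>y\<in>carrier M. h (x \<oplus>\<^bsub>M\<^esub> y) = h x \<oplus>\<^bsub>N\<^esub> h y) \<and>
     (\<forall>a\<in>carrier R. \<forall>x\<in>carrier M. h (a \<odot>\<^bsub>M\<^esub> x) = a \<odot>\<^bsub>N\<^esub> h x) \<and>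
     (\<forall>n. h ` H n \<subseteq> K n)}"

definition graded_ring_iso ::
  "('a, 'c) ring_scheme \<Rightarrow> (int \<Rightarrow> 'a set) \<Rightarrow> ('b, 'd) ring_scheme \<Rightarrow> (int \<Rightarrow> 'b set) \<Rightarrow> ('a \<Rightarrow> 'b) set"
  where
  "graded_ring_iso R G S H = {h \<in> ring_iso R S. \<forall>n. h ` G n = H n}"

definition homogeneous_ideal :: "('a, 'c) ring_scheme \<Rightarrow> (int \<Rightarrow> 'a set) \<Rightarrow> 'a set \<Rightarrow> bool" where
  "homogeneous_ideal R G J \<longleftrightarrow> ideal J R \<and>
     (\<forall>x\<in>J. \<exists>c. (\<forall>n. c n \<in> J \<inter> G n) \<and> finite {n. c n \<noteq> \<zero>\<^bsub>R\<^esub>} \<and>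
        x = finsum R c {n. c n \<noteq> \<zero>\<^bsub>R\<^esub>})"

text \<open>An ideal regarded as a module; the fields \<open>mult\<close> and \<open>one\<close> play no role.\<close>

definition ideal_module :: "('a, 'c) ring_scheme \<Rightarrow> 'a set \<Rightarrow> ('a, 'a) module" where
  "ideal_module R J = \<lparr>carrier = J, monoid.mult = monoid.mult R, one = \<one>\<^bsub>R\<^esub>,
     ring.zero = \<zero>\<^bsub>R\<^esub>, ring.add = ring.add R, module.smult = monoid.mult R\<rparr>"

text \<open>The grading on the image in \<open>R Quot I\<close>.\<close>

definition quotient_grading ::
  "('a, 'c) ring_scheme \<Rightarrow> (int \<Rightarrow> 'a set) \<Rightarrow> 'a set \<Rightarrow> int \<Rightarrow> 'a set set" where
  "quotient_grading R G I n = (\<lambda>x. I +>\<^bsub>R\<^esub> x) ` G n"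


section \<open>Finiteness conditions\<close>

definition finitely_generated_ideal ::
  "('a, 'c) ring_scheme \<Rightarrow> (int \<Rightarrow> 'a set) \<Rightarrow> 'a set \<Rightarrow> bool" where
  "finitely_generated_ideal R G J \<longleftrightarrow> (\<exists>S. finite S \<and> S \<subseteq> (\<Union>n. G n) \<and> J = Idl\<^bsub>R\<^esub> S)"

definition graded_noetherian :: "('a, 'c) ring_scheme \<Rightarrow> (int \<Rightarrow> 'a set) \<Rightarrow> bool" where
  "graded_noetherian R G \<longleftrightarrow> (\<forall>J. homogeneous_ideal R G J \<longrightarrow> finitely_generated_ideal R G J)"

text \<open>
  The direct sum of the shifted modules \<open>\<Sigma>\<^sup>d R\<close>, where \<open>d\<close> runs through the list \<open>ds\<close> and
  \<open>(\<Sigma>\<^sup>d R)\<^sub>n = R\<^sub>n\<^sub>-\<^sub>d\<close>. Again \<open>mult\<close> and \<open>one\<close> play no role.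
\<close>

definition free_module :: "('a, 'c) ring_scheme \<Rightarrow> int list \<Rightarrow> ('a, nat \<Rightarrow> 'a) module" where
  "free_module R ds = \<lparr>carrier = {..<length ds} \<rightarrow>\<^sub>E carrier R,
     monoid.mult = (\<lambda>u v. \<lambda>i\<in>{..<length ds}. u i \<otimes>\<^bsub>R\<^esub> v i),
     one = (\<lambda>i\<in>{..<length ds}. \<one>\<^bsub>R\<^esub>),
     ring.zero = (\<lambda>i\<in>{..<length ds}. \<zero>\<^bsub>R\<^esub>),
     ring.add = (\<lambda>u v. \<lambda>i\<in>{..<length ds}. u i \<oplus>\<^bsub>R\<^esub> v i),
     module.smult = (\<lambda>a u. \<lambda>i\<in>{..<length ds}. a \<otimes>\<^bsub>R\<^esub> u i)\<rparr>"

definition free_grading :: "(int \<Rightarrow> 'a set) \<Rightarrow> int list \<Rightarrow> int \<Rightarrow> (nat \<Rightarrow> 'a) set" where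
  "free_grading G ds n = (\<Pi>\<^sub>E i\<in>{..<length ds}. G (n - ds ! i))"

definition finitely_presented ::
  "('a, 'c) ring_scheme \<Rightarrow> (int \<Rightarrow> 'a set) \<Rightarrow> ('a, 'b, 'd) module_scheme \<Rightarrow> (int \<Rightarrow> 'b set) \<Rightarrow> bool"
  where
  "finitely_presented R G M H \<longleftrightarrow> (\<exists>es ds f g.
     f \<in> graded_hom R (free_module R es) (free_grading G es) (free_module R ds) (free_grading G ds) \<and>
     g \<in> graded_hom R (free_module R ds) (free_grading G ds) M H \<and>
     f ` carrier (free_module R es) = {u \<in> carrier (free_module R ds). g u = \<zero>\<^bsub>M\<^esub>} \<and>
     g ` carrier (free_module R ds) = carrier M)"

definition totally_incoherent :: "('a, 'c) ring_scheme \<Rightarrow> (int \<Rightarrow> 'a set) \<Rightarrow> bool" where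
  "totally_incoherent R G \<longleftrightarrow>
     {J. homogeneous_ideal R G J \<and> finitely_presented R G (ideal_module R J) (\<lambda>n. J \<inter> G n)} =
     {{\<zero>\<^bsub>R\<^esub>}, carrier R}"


section \<open>Annihilators, injectivity, nilpotents\<close>

definition ann :: "('a, 'c) ring_scheme \<Rightarrow> 'a set \<Rightarrow> 'a set" where
  "ann R J = {a \<in> carrier R. \<forall>b\<in>J. a \<otimes>\<^bsub>R\<^esub> b = \<zero>\<^bsub>R\<^esub>}"

definition double_annihilator_condition :: "('a, 'c) ring_scheme \<Rightarrow> (int \<Rightarrow> 'a set) \<Rightarrow> bool" where
  "double_annihilator_condition R G \<longleftrightarrow>
     (\<forall>J. finitely_generated_ideal R G J \<longrightarrow> ann R (ann R J) = J)"

text \<open>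
  Injectivity of \<open>I\<close> in the category of graded modules. HOL cannot quantify over modules of all types
  at once, so the type \<open>'m\<close> is the universe from which the test modules \<open>M\<close> and \<open>N\<close> take their
  elements. By the graded Baer criterion the condition on a countable ring does not depend on \<open>'m\<close>
  as long as \<open>'m\<close> is infinite; \<open>I\<close> itself need not live in \<open>'m\<close>.
\<close>

definition graded_injective ::
  "'m itself \<Rightarrow> ('a, 'c) ring_scheme \<Rightarrow> (int \<Rightarrow> 'a set) \<Rightarrow>
   ('a, 'b, 'd) module_scheme \<Rightarrow> (int \<Rightarrow> 'b set) \<Rightarrow> bool" where
  "graded_injective _ R G I K \<longleftrightarrow>
     (\<forall>(M :: ('a, 'm) module) H (N :: ('a, 'm) module) L i f.
        graded_module R G M H \<and> graded_module R G N L \<and>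
        i \<in> graded_hom R M H N L \<and> inj_on i (carrier M) \<and>
        f \<in> graded_hom R M H I K \<longrightarrow>
        (\<exists>g \<in> graded_hom R N L I K. \<forall>x\<in>carrier M. g (i x) = f x))"

definition self_injective ::
  "'m itself \<Rightarrow> ('a, 'c) ring_scheme \<Rightarrow> (int \<Rightarrow> 'a set) \<Rightarrow> bool" where
  "self_injective U R G \<longleftrightarrow> graded_injective U R G (ideal_module R (carrier R)) G"

definition nilradical :: "('a, 'c) ring_scheme \<Rightarrow> 'a set" where
  "nilradical R = {a \<in> carrier R. \<exists>n::nat. a [^]\<^bsub>R\<^esub> n = \<zero>\<^bsub>R\<^esub>}"


section \<open>The Rado algebra\<close>

definition B :: "nat \<Rightarrow> nat set" where
  "B n = (THE S. finite S \<and> n = (\<Sum>i\<in>S. 2 ^ i))"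

text \<open>The set exists and is unique, so the description above denotes it.\<close>

lemma B_eq: "finite S \<and> n = (\<Sum>i\<in>S. 2 ^ i) \<longleftrightarrow> S = set_decode n"
  by (metis finite_set_decode set_decode_inverse set_encode_def set_encode_inverse)

lemma B_eq_set_decode: "B n = set_decode n"
  unfolding B_def B_eq by simp

definition rado_edge :: "nat \<Rightarrow> nat \<Rightarrow> bool" where
  "rado_edge i j \<longleftrightarrow> i \<in> B j \<or> j \<in> B i"

text \<open>
  The field \<open>\<F> = \<int>/2\<close> is the type \<^typ>\<open>bit\<close>. The polynomial ring \<open>\<F>[x\<^sub>0, x\<^sub>1, \<dots>]\<close> is the
  monoid algebra of the free commutative monoid \<^typ>\<open>nat \<Rightarrow>\<^sub>0 nat\<close> of exponents.
\<close>

type_synonym rado_poly = "(nat \<Rightarrow>\<^sub>0 nat) \<Rightarrow>\<^sub>0 bit"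

definition field_two :: "bit ring" where
  "field_two = ring_of_type_algebra"

definition field_two_grading :: "int \<Rightarrow> bit set" where
  "field_two_grading n = (if n = 0 then UNIV else {0})"

definition F_poly_ring :: "rado_poly ring" where
  "F_poly_ring = ring_of_type_algebra"

definition indet :: "nat \<Rightarrow> rado_poly" where
  "indet i = Poly_Mapping.single (Poly_Mapping.single i 1) 1"

definition exponent_degree :: "(nat \<Rightarrow>\<^sub>0 nat) \<Rightarrow> nat" where
  "exponent_degree m = (\<Sum>i\<in>Poly_Mapping.keys m. Poly_Mapping.lookup m i * 2 ^ i)"

definition poly_grading :: "int \<Rightarrow> rado_poly set" where
  "poly_grading n = {p. \<forall>m\<in>Poly_Mapping.keys p. int (exponent_degree m) = n}"

definition squares_ideal :: "rado_poly set" where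
  "squares_ideal = Idl\<^bsub>F_poly_ring\<^esub> {indet i ^ 2 | i. True}"

definition E :: "rado_poly set ring" where
  "E = F_poly_ring Quot squares_ideal"

definition E_grading :: "int \<Rightarrow> rado_poly set set" where
  "E_grading = quotient_grading F_poly_ring poly_grading squares_ideal"

definition E_indet :: "nat \<Rightarrow> rado_poly set" where
  "E_indet i = squares_ideal +>\<^bsub>F_poly_ring\<^esub> indet i"

definition rado_ideal :: "rado_poly set set" where
  "rado_ideal = Idl\<^bsub>E\<^esub> {E_indet i \<otimes>\<^bsub>E\<^esub> E_indet j | i j. \<not> rado_edge i j}"

definition Q :: "rado_poly set set ring" where
  "Q = E Quot rado_ideal"

definition Q_grading :: "int \<Rightarrow> rado_poly set set set" where
  "Q_grading = quotient_grading E E_grading rado_ideal"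


section \<open>The Rado algebra is a graded ring\<close>

definition supp_sum :: "('a, 'c) ring_scheme \<Rightarrow> (int \<Rightarrow> 'a) \<Rightarrow> 'a" where
  "supp_sum M c = finsum M c {n. c n \<noteq> \<zero>\<^bsub>M\<^esub>}"

lemma (in abelian_group) supp_sum_superset:
  assumes "finite A" "{n. c n \<noteq> \<zero>} \<subseteq> A" "\<And>n. c n \<in> carrier G"
  shows "supp_sum G c = finsum G c A"
  unfolding supp_sum_def
  using assms by (intro add.finprod_mono_neutral_cong_left) auto

lemma (in abelian_group) supp_sum_add:
  assumes "finite {n. c n \<noteq> \<zero>}" "finite {n. d n \<noteq> \<zero>}" "\<And>n. c n \<in> carrier G" "\<And>n. d n \<in> carrier G"
  shows "supp_sum G c \<oplus> supp_sum G d = supp_sum G (\<lambda>n. c n \<oplus> d n)"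
    "finite {n. c n \<oplus> d n \<noteq> \<zero>}"
proof -
  let ?A = "{n. c n \<noteq> \<zero>} \<union> {n. d n \<noteq> \<zero>}"
  have s: "{n. c n \<oplus> d n \<noteq> \<zero>} \<subseteq> ?A" by auto
  then show "finite {n. c n \<oplus> d n \<noteq> \<zero>}" using assms by (meson finite_Un finite_subset)
  show "supp_sum G c \<oplus> supp_sum G d = supp_sum G (\<lambda>n. c n \<oplus> d n)"
    using assms s
    by (subst (1 2 3) supp_sum_superset[of ?A]) (auto intro!: finsum_addf[symmetric])
qed

lemma homogeneous_span_aux:
  assumes R: "cring R" and g: "\<And>n. additive_subgroup (G n) R" and I: "ideal I R"
    and x: "finite A" "\<And>n. n \<in> A \<Longrightarrow> c n \<in> I \<inter> G (d n)"
  shows "\<exists>c'. (\<forall>n. c' n \<in> I \<inter> G n) \<and> finite {n. c' n \<noteq> \<zero>\<^bsub>R\<^esub>} \<and> finsum R c A = supp_sum R c'"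
  using x
proof (induction A)
  case empty
  interpret cring R by fact
  interpret ideal I R by fact
  show ?case
    using additive_subgroup.zero_closed[OF g] a_subgroup additive_subgroup.zero_closed
    by (intro exI[of _ "\<lambda>n. \<zero>\<^bsub>R\<^esub>"]) (auto simp: supp_sum_def)
next
  case (insert a A)
  interpret cring R by fact
  interpret ideal I R by fact
  obtain c' where c': "\<And>n. c' n \<in> I \<inter> G n" "finite {n. c' n \<noteq> \<zero>\<^bsub>R\<^esub>}" "finsum R c A = supp_sum R c'"
    using insert by auto
  define e where "e n = (if n = d a then c a else \<zero>\<^bsub>R\<^esub>)" for n
  have e: "\<And>n. e n \<in> I \<inter> G n" using insert.prems additive_subgroup.zero_closed[OF g] by (auto simp: e_def)
  have IR: "\<And>x. x \<in> I \<Longrightarrow> x \<in> carrier R" using a_subset by auto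
  have ef: "finite {n. e n \<noteq> \<zero>\<^bsub>R\<^esub>}" by (rule finite_subset[of _ "{d a}"]) (auto simp: e_def)
  have "supp_sum R e = finsum R e {d a}"
    using e IR by (intro supp_sum_superset) (auto simp: e_def)
  also have "\<dots> = c a" using IR insert.prems by (auto simp: e_def)
  finally have "finsum R c (insert a A) = supp_sum R e \<oplus>\<^bsub>R\<^esub> supp_sum R c'"
    using insert c' IR by (subst finsum_insert) auto
  also have "\<dots> = supp_sum R (\<lambda>n. e n \<oplus>\<^bsub>R\<^esub> c' n)"
    using supp_sum_add(1)[of e c'] e c' IR ef by auto
  finally have "finsum R c (insert a A) = supp_sum R (\<lambda>n. e n \<oplus>\<^bsub>R\<^esub> c' n)" .
  moreover have "finite {n. e n \<oplus>\<^bsub>R\<^esub> c' n \<noteq> \<zero>\<^bsub>R\<^esub>}"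
    using supp_sum_add(2)[of e c'] e c' IR ef by auto
  moreover have "\<forall>n. e n \<oplus>\<^bsub>R\<^esub> c' n \<in> I \<inter> G n"
    using e c' additive_subgroup.a_closed[OF g] by auto
  ultimately show ?case by (intro exI[of _ "\<lambda>n. e n \<oplus>\<^bsub>R\<^esub> c' n"]) simp
qed

lemma homogeneous_Idl:
  assumes gr: "graded_ring R G" and S: "S \<subseteq> (\<Union>n. G n)"
  shows "homogeneous_ideal R G (Idl\<^bsub>R\<^esub> S)"
proof -
  interpret cring R using gr by (simp add: graded_ring_def)
  have g: "\<And>n. additive_subgroup (G n) R" using gr by (simp add: graded_ring_def graded_by_def)
  have gR: "\<And>n x. x \<in> G n \<Longrightarrow> x \<in> carrier R" using additive_subgroup.a_subset[OF g] by auto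
  have m: "\<And>m n a b. a \<in> G m \<Longrightarrow> b \<in> G n \<Longrightarrow> a \<otimes>\<^bsub>R\<^esub> b \<in> G (m + n)" using gr by (simp add: graded_ring_def)
  have dec: "\<And>x. x \<in> carrier R \<Longrightarrow> \<exists>c. (\<forall>n. c n \<in> G n) \<and> finite {n. c n \<noteq> \<zero>\<^bsub>R\<^esub>} \<and> x = supp_sum R c"
    using gr unfolding graded_ring_def graded_by_def supp_sum_def by blast
  have SR: "S \<subseteq> carrier R" using S gR by auto
  let ?I = "Idl\<^bsub>R\<^esub> S"
  interpret I: ideal ?I R using genideal_ideal[OF SR] .
  define K where "K = {x. \<exists>c. (\<forall>n. c n \<in> ?I \<inter> G n) \<and> finite {n. c n \<noteq> \<zero>\<^bsub>R\<^esub>} \<and> x = supp_sum R c}"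
  have IR: "\<And>x. x \<in> ?I \<Longrightarrow> x \<in> carrier R" using I.a_subset by auto
  have KR: "K \<subseteq> carrier R" unfolding K_def supp_sum_def
    using IR by (auto intro!: finsum_closed)
  have hom: "x \<in> K" if "x \<in> ?I \<inter> G n" for x n
    using homogeneous_span_aux[OF is_cring g I.is_ideal, of "{n}" "\<lambda>_. x" "\<lambda>n. n"] that IR
    by (auto simp: K_def)
  have add: "x \<oplus>\<^bsub>R\<^esub> y \<in> K" if "x \<in> K" "y \<in> K" for x y
  proof -
    from that obtain c d where c: "\<forall>n. c n \<in> ?I \<inter> G n" "finite {n. c n \<noteq> \<zero>\<^bsub>R\<^esub>}" "x = supp_sum R c"
      and d: "\<forall>n. d n \<in> ?I \<inter> G n" "finite {n. d n \<noteq> \<zero>\<^bsub>R\<^esub>}" "y = supp_sum R d"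
      unfolding K_def by blast
    have "x \<oplus>\<^bsub>R\<^esub> y = supp_sum R (\<lambda>n. c n \<oplus>\<^bsub>R\<^esub> d n)" "finite {n. c n \<oplus>\<^bsub>R\<^esub> d n \<noteq> \<zero>\<^bsub>R\<^esub>}"
      using supp_sum_add[of c d] c d IR by auto
    moreover have "\<forall>n. c n \<oplus>\<^bsub>R\<^esub> d n \<in> ?I \<inter> G n"
      using c d additive_subgroup.a_closed[OF g] by auto
    ultimately show ?thesis unfolding K_def
      by (intro CollectI exI[of _ "\<lambda>n. c n \<oplus>\<^bsub>R\<^esub> d n"]) simp
  qed
  have zero: "\<zero>\<^bsub>R\<^esub> \<in> K" using hom[of "\<zero>\<^bsub>R\<^esub>" 0] additive_subgroup.zero_closed[OF g] by auto
  have fs: "finsum R f A \<in> K" if "finite A" "\<And>n. n \<in> A \<Longrightarrow> f n \<in> K" for f :: "int \<Rightarrow> 'a" and A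
    using that
  proof (induction A)
    case empty then show ?case using zero by simp
  next
    case (insert a A)
    then have "f \<in> A \<rightarrow> carrier R" "f a \<in> carrier R" using KR by auto
    then show ?case using insert add by (subst finsum_insert) auto
  qed
  have mul: "r \<otimes>\<^bsub>R\<^esub> x \<in> K" if r: "r \<in> carrier R" and x: "x \<in> K" for r x
  proof -
    from x obtain c where c: "\<forall>n. c n \<in> ?I \<inter> G n" "finite {n. c n \<noteq> \<zero>\<^bsub>R\<^esub>}" "x = supp_sum R c"
      unfolding K_def by blast
    from dec[OF r] obtain d where d: "\<forall>n. d n \<in> G n" "finite {n. d n \<noteq> \<zero>\<^bsub>R\<^esub>}" "r = supp_sum R d"
      by blast
    have xR: "x \<in> carrier R" using x KR by auto
    have "r \<otimes>\<^bsub>R\<^esub> x = finsum R (\<lambda>m. d m \<otimes>\<^bsub>R\<^esub> x) {n. d n \<noteq> \<zero>\<^bsub>R\<^esub>}"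
      unfolding d(3) supp_sum_def using d gR xR by (intro finsum_ldistr) auto
    also have "\<dots> \<in> K"
    proof (rule fs)
      fix m
      have dm: "d m \<in> carrier R" using d gR by auto
      have "d m \<otimes>\<^bsub>R\<^esub> x = finsum R (\<lambda>n. d m \<otimes>\<^bsub>R\<^esub> c n) {n. c n \<noteq> \<zero>\<^bsub>R\<^esub>}"
        unfolding c(3) supp_sum_def using c IR dm by (intro finsum_rdistr) auto
      also have "\<dots> \<in> K"
        using c d dm m I.I_l_closed by (intro fs hom) blast+
      finally show "d m \<otimes>\<^bsub>R\<^esub> x \<in> K" .
    qed (use d in auto)
    finally show ?thesis .
  qed
  have "ideal K R"
  proof (rule idealI)
    show "ring R" by (rule ring_axioms)
    show "subgroup K (add_monoid R)"
    proof (rule add.subgroupI)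
      show "K \<subseteq> carrier R" by fact
      show "K \<noteq> {}" using zero by auto
      show "\<ominus>\<^bsub>R\<^esub> a \<in> K" if "a \<in> K" for a
        using mul[of "\<ominus>\<^bsub>R\<^esub> \<one>\<^bsub>R\<^esub>" a] that KR by (auto simp: l_minus)
    qed (use add in auto)
    show "\<And>a x. a \<in> K \<Longrightarrow> x \<in> carrier R \<Longrightarrow> x \<otimes>\<^bsub>R\<^esub> a \<in> K" using mul by auto
    show "a \<otimes>\<^bsub>R\<^esub> x \<in> K" if "a \<in> K" "x \<in> carrier R" for a x
      using mul[of x a] m_comm[of x a] that KR by auto
  qed
  moreover have "S \<subseteq> K" using S hom genideal_self[OF SR] by blast
  ultimately have "?I \<subseteq> K" by (rule genideal_minimal)
  then show ?thesis
    unfolding homogeneous_ideal_def K_def supp_sum_def using I.is_ideal by blast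
qed

lemma Quot_surj:
  "Y \<in> carrier (R Quot I) \<Longrightarrow> \<exists>x\<in>carrier R. Y = I +>\<^bsub>R\<^esub> x"
  by (auto simp: FactRing_def A_RCOSETS_def RCOSETS_def a_r_coset_def)

lemma graded_quotient:
  assumes gr: "graded_ring R G" and I: "homogeneous_ideal R G I"
  shows "graded_ring (R Quot I) (quotient_grading R G I)"
proof -
  interpret cring R using gr by (simp add: graded_ring_def)
  have g: "\<And>n. additive_subgroup (G n) R" using gr by (simp add: graded_ring_def graded_by_def)
  have gR: "\<And>n x. x \<in> G n \<Longrightarrow> x \<in> carrier R" using additive_subgroup.a_subset[OF g] by auto
  have m: "\<And>m n a b. a \<in> G m \<Longrightarrow> b \<in> G n \<Longrightarrow> a \<otimes>\<^bsub>R\<^esub> b \<in> G (m + n)" using gr by (simp add: graded_ring_def)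
  have dec: "\<And>x. x \<in> carrier R \<Longrightarrow> \<exists>!c. (\<forall>n. c n \<in> G n) \<and> finite {n. c n \<noteq> \<zero>\<^bsub>R\<^esub>} \<and> x = supp_sum R c"
    using gr unfolding graded_ring_def graded_by_def supp_sum_def by blast
  interpret I: ideal I R using I by (simp add: homogeneous_ideal_def)
  have IR: "\<And>x. x \<in> I \<Longrightarrow> x \<in> carrier R" using I.a_subset by auto
  let ?q = "\<lambda>x. I +>\<^bsub>R\<^esub> x" and ?Q = "R Quot I"
  have zeroQ: "\<zero>\<^bsub>?Q\<^esub> = I" unfolding FactRing_def by simp
  interpret Q: cring ?Q using I.quotient_is_cring is_cring by auto
  interpret h: ring_hom_cring R ?Q ?q using I.rcos_ring_hom_cring is_cring by auto
  have qz: "?q x = \<zero>\<^bsub>?Q\<^esub> \<longleftrightarrow> x \<in> I" if "x \<in> carrier R" for x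
    using I.a_rcos_self[OF that] I.a_rcos_const[of x] zeroQ by metis
  have surj: "\<exists>x\<in>carrier R. Y = ?q x" if "Y \<in> carrier ?Q" for Y
    using Quot_surj[OF that] .
  have fin: "finsum ?Q (\<lambda>n. ?q (c n)) A = ?q (finsum R c A)"
    if "\<And>n. c n \<in> carrier R" for c :: "int \<Rightarrow> 'a" and A
    using h.hom_finsum[of c A] that by (simp add: comp_def)
  have qg: "additive_subgroup (quotient_grading R G I n) ?Q" for n
  proof -
    have "subgroup (G n) (add_monoid R)" using g additive_subgroup.a_subgroup by blast
    then show ?thesis
      using ring_hom_ring.img_is_add_subgroup[OF I.rcos_ring_hom_ring, of "G n"]
      by (simp add: quotient_grading_def additive_subgroup_def)
  qed
  have ex: "\<exists>C. (\<forall>n. C n \<in> quotient_grading R G I n) \<and> finite {n. C n \<noteq> \<zero>\<^bsub>?Q\<^esub>} \<and> Y = supp_sum ?Q C"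
    if Y: "Y \<in> carrier ?Q" for Y
  proof -
    obtain x where x: "x \<in> carrier R" "Y = ?q x" using surj[OF Y] by blast
    then obtain c where c: "\<And>n. c n \<in> G n" "finite {n. c n \<noteq> \<zero>\<^bsub>R\<^esub>}" "x = supp_sum R c"
      using dec by blast
    have cR: "\<And>n. c n \<in> carrier R" using c(1) gR by blast
    let ?C = "\<lambda>n. ?q (c n)"
    have sub: "{n. ?C n \<noteq> \<zero>\<^bsub>?Q\<^esub>} \<subseteq> {n. c n \<noteq> \<zero>\<^bsub>R\<^esub>}" by auto
    have "Y = finsum ?Q ?C {n. c n \<noteq> \<zero>\<^bsub>R\<^esub>}" using x c cR fin by (simp add: supp_sum_def)
    also have "\<dots> = supp_sum ?Q ?C" using c sub cR by (intro Q.supp_sum_superset[symmetric]) auto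
    finally show ?thesis using c sub finite_subset[OF sub]
      by (intro exI[of _ ?C]) (auto simp: quotient_grading_def)
  qed
  have un: "C = D" if C: "\<forall>n. C n \<in> quotient_grading R G I n" "finite {n. C n \<noteq> \<zero>\<^bsub>?Q\<^esub>}"
     and D: "\<forall>n. D n \<in> quotient_grading R G I n" "finite {n. D n \<noteq> \<zero>\<^bsub>?Q\<^esub>}"
     and eq: "supp_sum ?Q C = supp_sum ?Q D" for C D
  proof -
    have lift: "\<exists>c. (\<forall>n. c n \<in> G n) \<and> finite {n. c n \<noteq> \<zero>\<^bsub>R\<^esub>} \<and> (\<forall>n. ?q (c n) = C n) \<and> supp_sum ?Q C = ?q (supp_sum R c)"
      if C: "\<forall>n. C n \<in> quotient_grading R G I n" "finite {n. C n \<noteq> \<zero>\<^bsub>?Q\<^esub>}" for C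
    proof -
      have "\<forall>n. \<exists>x\<in>G n. ?q x = C n" using C by (fastforce simp: quotient_grading_def)
      then obtain c0 where c0: "\<And>n. c0 n \<in> G n" "\<And>n. ?q (c0 n) = C n" by metis
      define c where "c n = (if C n = \<zero>\<^bsub>?Q\<^esub> then \<zero>\<^bsub>R\<^esub> else c0 n)" for n
      have c: "\<And>n. c n \<in> G n" "\<And>n. ?q (c n) = C n"
        using c0 additive_subgroup.zero_closed[OF g] by (auto simp: c_def simp flip: c0(2))
      have sub: "{n. c n \<noteq> \<zero>\<^bsub>R\<^esub>} \<subseteq> {n. C n \<noteq> \<zero>\<^bsub>?Q\<^esub>}" by (auto simp: c_def)
      have cR: "\<And>n. c n \<in> carrier R" using c(1) gR by blast
      have "supp_sum R c = finsum R c {n. C n \<noteq> \<zero>\<^bsub>?Q\<^esub>}"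
        using sub C cR by (intro supp_sum_superset) auto
      then have "?q (supp_sum R c) = supp_sum ?Q C"
        using fin[OF cR] c by (simp add: supp_sum_def)
      then show ?thesis using c finite_subset[OF sub C(2)] by metis
    qed
    obtain c where c: "\<And>n. c n \<in> G n" "finite {n. c n \<noteq> \<zero>\<^bsub>R\<^esub>}" "\<And>n. ?q (c n) = C n" "supp_sum ?Q C = ?q (supp_sum R c)"
      using lift[OF C] by blast
    obtain d where d: "\<And>n. d n \<in> G n" "finite {n. d n \<noteq> \<zero>\<^bsub>R\<^esub>}" "\<And>n. ?q (d n) = D n" "supp_sum ?Q D = ?q (supp_sum R d)"
      using lift[OF D] by blast
    have cR: "\<And>n. c n \<in> carrier R" using c(1) gR by blast
    have dR: "\<And>n. d n \<in> carrier R" using d(1) gR by blast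
    have sR: "supp_sum R c \<in> carrier R" "supp_sum R d \<in> carrier R"
      unfolding supp_sum_def using cR dR by (auto intro!: finsum_closed)
    let ?z = "supp_sum R c \<ominus>\<^bsub>R\<^esub> supp_sum R d"
    have "?q ?z = ?q (supp_sum R c) \<ominus>\<^bsub>?Q\<^esub> ?q (supp_sum R d)"
      using sR by (simp add: a_minus_def)
    also have "\<dots> = \<zero>\<^bsub>?Q\<^esub>" using eq c d sR by (simp add: a_minus_def Q.r_neg)
    finally have "?z \<in> I" using qz[of ?z] sR by blast
    then obtain e where e: "\<And>n. e n \<in> I \<inter> G n" "finite {n. e n \<noteq> \<zero>\<^bsub>R\<^esub>}" "?z = supp_sum R e"
      using I unfolding homogeneous_ideal_def supp_sum_def by blast
    have eR: "\<And>n. e n \<in> carrier R" using e(1) gR by blast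
    have "supp_sum R c = supp_sum R e \<oplus>\<^bsub>R\<^esub> supp_sum R d"
      unfolding e(3)[symmetric] using sR by (simp add: a_minus_def a_assoc l_neg)
    also have "\<dots> = supp_sum R (\<lambda>n. e n \<oplus>\<^bsub>R\<^esub> d n)"
      using supp_sum_add(1)[of e d] e d eR dR by auto
    finally have s: "supp_sum R c = supp_sum R (\<lambda>n. e n \<oplus>\<^bsub>R\<^esub> d n)" .
    have f: "finite {n. e n \<oplus>\<^bsub>R\<^esub> d n \<noteq> \<zero>\<^bsub>R\<^esub>}" using supp_sum_add(2)[of e d] e d eR dR by auto
    have gg: "\<forall>n. e n \<oplus>\<^bsub>R\<^esub> d n \<in> G n" using e d additive_subgroup.a_closed[OF g] by auto
    have ce: "c = (\<lambda>n. e n \<oplus>\<^bsub>R\<^esub> d n)"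
    proof (rule ex1E[OF dec[OF sR(1)]])
      fix u assume u: "\<forall>v. (\<forall>n. v n \<in> G n) \<and> finite {n. v n \<noteq> \<zero>\<^bsub>R\<^esub>} \<and> supp_sum R c = supp_sum R v \<longrightarrow> v = u"
      have "c = u" using u c(1,2) by blast
      moreover have "(\<lambda>n. e n \<oplus>\<^bsub>R\<^esub> d n) = u" using gg f s by (intro u[rule_format]) blast
      ultimately show ?thesis by simp
    qed
    show "C = D"
    proof
      fix n
      have "?q (e n) = \<zero>\<^bsub>?Q\<^esub>" using qz[OF eR] e(1) by blast
      then have "?q (c n) = ?q (d n)" unfolding ce using eR dR by simp
      then show "C n = D n" using c d by simp
    qed
  qed
  have "graded_by ?Q (quotient_grading R G I)"
    unfolding graded_by_def supp_sum_def[symmetric]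
  proof (intro conjI allI ballI qg)
    fix Y assume Y: "Y \<in> carrier ?Q"
    show "\<exists>!C. (\<forall>n. C n \<in> quotient_grading R G I n) \<and> finite {n. C n \<noteq> \<zero>\<^bsub>?Q\<^esub>} \<and> Y = supp_sum ?Q C"
    proof (rule ex_ex1I)
      show "C = D" if "(\<forall>n. C n \<in> quotient_grading R G I n) \<and> finite {n. C n \<noteq> \<zero>\<^bsub>?Q\<^esub>} \<and> Y = supp_sum ?Q C"
        "(\<forall>n. D n \<in> quotient_grading R G I n) \<and> finite {n. D n \<noteq> \<zero>\<^bsub>?Q\<^esub>} \<and> Y = supp_sum ?Q D" for C D
        by (rule un) (use that in simp_all)
    qed (rule ex[OF Y])
  qed
  moreover have "\<one>\<^bsub>?Q\<^esub> \<in> quotient_grading R G I 0"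
    using gr h.hom_one unfolding quotient_grading_def graded_ring_def by (metis imageI)
  moreover have "A \<otimes>\<^bsub>?Q\<^esub> A' \<in> quotient_grading R G I (k + n)"
    if "A \<in> quotient_grading R G I k" "A' \<in> quotient_grading R G I n" for A A' k n
  proof -
    from that obtain a b where ab: "a \<in> G k" "b \<in> G n" "A = ?q a" "A' = ?q b"
      by (auto simp: quotient_grading_def)
    then have "A \<otimes>\<^bsub>?Q\<^esub> A' = ?q (a \<otimes>\<^bsub>R\<^esub> b)" using gR by simp
    then show ?thesis using m ab by (auto simp: quotient_grading_def)
  qed
  ultimately show ?thesis unfolding graded_ring_def using Q.is_cring by blast
qed

lemma cring_poly_ring: "cring F_poly_ring"
  unfolding F_poly_ring_def by (rule cring_from_type_algebra)

lemma poly_ring_simps: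
  "carrier F_poly_ring = UNIV" "x \<otimes>\<^bsub>F_poly_ring\<^esub> y = x * y" "x \<oplus>\<^bsub>F_poly_ring\<^esub> y = x + y"
  "\<one>\<^bsub>F_poly_ring\<^esub> = 1" "\<zero>\<^bsub>F_poly_ring\<^esub> = 0"
  by (simp_all add: F_poly_ring_def ring_of_type_algebra_def)

lemma finsum_poly_ring: "finite A \<Longrightarrow> finsum F_poly_ring f A = sum f A"
proof (induction A rule: finite_induct)
  interpret cring F_poly_ring by (rule cring_poly_ring)
  {
    case empty show ?case by (simp add: poly_ring_simps)
  next
    case (insert a A) then show ?case by (subst finsum_insert) (auto simp: poly_ring_simps)
  }
qed

lemma exponent_degree_superset:
  "finite A \<Longrightarrow> Poly_Mapping.keys m \<subseteq> A \<Longrightarrow> exponent_degree m = (\<Sum>i\<in>A. Poly_Mapping.lookup m i * 2 ^ i)"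
  unfolding exponent_degree_def
  by (intro sum.mono_neutral_left) (auto simp: in_keys_iff)

lemma exponent_degree_add: "exponent_degree (m + n) = exponent_degree m + exponent_degree n"
proof -
  let ?A = "Poly_Mapping.keys m \<union> Poly_Mapping.keys n"
  have "exponent_degree (m + n) = (\<Sum>i\<in>?A. Poly_Mapping.lookup (m + n) i * 2 ^ i)"
    by (intro exponent_degree_superset) (auto simp: Poly_Mapping.keys_add)
  then show ?thesis
    by (simp add: exponent_degree_superset[of ?A m] exponent_degree_superset[of ?A n]
        lookup_add distrib_right sum.distrib)
qed

lemma graded_poly_ring: "graded_ring F_poly_ring poly_grading"
proof -
  interpret cring F_poly_ring by (rule cring_poly_ring)
  have sub: "additive_subgroup (poly_grading n) F_poly_ring" for n
  proof -
    have inv: "\<ominus>\<^bsub>F_poly_ring\<^esub> a = - a" for a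
      by (rule sum_zero_eq_neg[symmetric]) (auto simp: poly_ring_simps)
    show ?thesis
      unfolding additive_subgroup_def
    proof (rule add.subgroupI)
      show "poly_grading n \<noteq> {}" by (auto simp: poly_grading_def intro!: exI[of _ 0])
      show "\<ominus>\<^bsub>F_poly_ring\<^esub> a \<in> poly_grading n" if "a \<in> poly_grading n" for a
        using that unfolding inv by (simp add: poly_grading_def)
      show "a \<oplus>\<^bsub>F_poly_ring\<^esub> b \<in> poly_grading n" if "a \<in> poly_grading n" "b \<in> poly_grading n" for a b
        using that Poly_Mapping.keys_add[of a b] by (auto simp: poly_grading_def poly_ring_simps)
    qed (auto simp: poly_ring_simps)
  qed
  have key: "Poly_Mapping.lookup (sum c {n. c n \<noteq> 0}) m = Poly_Mapping.lookup (c (int (exponent_degree m))) m"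
    if c: "\<forall>n. c n \<in> poly_grading n" "finite {n. c n \<noteq> 0}" for c m
  proof -
    have z: "Poly_Mapping.lookup (c n) m = 0" if "n \<noteq> int (exponent_degree m)" for n
      using c(1) that by (force simp: poly_grading_def in_keys_iff)
    have "Poly_Mapping.lookup (sum c {n. c n \<noteq> 0}) m = (\<Sum>n\<in>{n. c n \<noteq> 0}. Poly_Mapping.lookup (c n) m)"
      by (rule lookup_sum)
    also have "\<dots> = (\<Sum>n\<in>{n. c n \<noteq> 0}. if n = int (exponent_degree m) then Poly_Mapping.lookup (c n) m else 0)"
      using z by (intro sum.cong) auto
    finally show ?thesis using c by auto
  qed
  have "graded_by F_poly_ring poly_grading"
    unfolding graded_by_def
  proof (intro conjI allI ballI sub)
    fix p :: rado_poly
    let ?P = "\<lambda>c. (\<forall>n. c n \<in> poly_grading n) \<and> finite {n. c n \<noteq> \<zero>\<^bsub>F_poly_ring\<^esub>} \<and>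
        p = finsum F_poly_ring c {n. c n \<noteq> \<zero>\<^bsub>F_poly_ring\<^esub>}"
    define c where "c n = (\<Sum>m\<in>{m\<in>Poly_Mapping.keys p. int (exponent_degree m) = n}.
       Poly_Mapping.single m (Poly_Mapping.lookup p m))" for n
    have lc: "Poly_Mapping.lookup (c n) m = (if int (exponent_degree m) = n then Poly_Mapping.lookup p m else 0)" for n m
    proof -
      have "Poly_Mapping.lookup (c n) m = (\<Sum>k\<in>{m\<in>Poly_Mapping.keys p. int (exponent_degree m) = n}.
         if k = m then Poly_Mapping.lookup p m else 0)"
        unfolding c_def lookup_sum by (intro sum.cong) (auto simp: lookup_single)
      also have "\<dots> = (if m \<in> {m\<in>Poly_Mapping.keys p. int (exponent_degree m) = n} then Poly_Mapping.lookup p m else 0)"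
        by (rule sum.delta) simp
      finally show ?thesis by (simp add: in_keys_iff)
    qed
    have c1: "\<forall>n. c n \<in> poly_grading n"
      by (auto simp: poly_grading_def in_keys_iff lc split: if_splits)
    have "{n. c n \<noteq> 0} \<subseteq> (\<lambda>m. int (exponent_degree m)) ` Poly_Mapping.keys p"
    proof
      fix n assume "n \<in> {n. c n \<noteq> 0}"
      then obtain m where "Poly_Mapping.lookup (c n) m \<noteq> 0"
        by (metis (mono_tags) lookup_zero mem_Collect_eq poly_mapping_eqI)
      then show "n \<in> (\<lambda>m. int (exponent_degree m)) ` Poly_Mapping.keys p"
        by (auto simp: lc in_keys_iff split: if_splits)
    qed
    then have c2: "finite {n. c n \<noteq> 0}" by (rule finite_subset) simp
    have "p = sum c {n. c n \<noteq> 0}"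
      by (rule poly_mapping_eqI) (simp add: key[OF c1 c2] lc)
    then have "?P c" using c1 c2 by (simp add: finsum_poly_ring poly_ring_simps)
    moreover have "d = c" if "?P d" for d
    proof -
      have d: "\<forall>n. d n \<in> poly_grading n" "finite {n. d n \<noteq> 0}" "p = sum d {n. d n \<noteq> 0}"
        using that by (simp_all add: finsum_poly_ring poly_ring_simps)
      show ?thesis
      proof (intro ext poly_mapping_eqI)
        fix n m
        show "Poly_Mapping.lookup (d n) m = Poly_Mapping.lookup (c n) m"
        proof (cases "int (exponent_degree m) = n")
          case True
          then show ?thesis using key[OF d(1,2), of m] d(3) by (simp add: lc)
        next
          case False
          then have "Poly_Mapping.lookup (d n) m = 0" using d(1) by (force simp: poly_grading_def in_keys_iff)
          then show ?thesis using False by (simp add: lc)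
        qed
      qed
    qed
    ultimately show "\<exists>!c. ?P c" by blast
  qed
  moreover have "\<one>\<^bsub>F_poly_ring\<^esub> \<in> poly_grading 0"
    by (auto simp: poly_grading_def poly_ring_simps exponent_degree_def)
  moreover have "a \<otimes>\<^bsub>F_poly_ring\<^esub> b \<in> poly_grading (k + n)"
    if "a \<in> poly_grading k" "b \<in> poly_grading n" for a b k n
    using that Poly_Mapping.keys_mult[of a b]
    by (fastforce simp: poly_grading_def poly_ring_simps exponent_degree_add)
  ultimately show ?thesis unfolding graded_ring_def using cring_poly_ring by blast
qed

lemma indet_homogeneous: "indet i \<in> poly_grading (2 ^ i)"
  by (auto simp: indet_def poly_grading_def exponent_degree_def)

lemma graded_E: "graded_ring E E_grading"
proof -
  have m: "\<And>i. indet i * indet i \<in> poly_grading (2 ^ i + 2 ^ i)"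
    using graded_poly_ring indet_homogeneous unfolding graded_ring_def poly_ring_simps by blast
  have "{indet i ^ 2 | i. True} \<subseteq> (\<Union>n. poly_grading n)"
    using m by (auto simp: power2_eq_square)
  from homogeneous_Idl[OF graded_poly_ring this] graded_quotient[OF graded_poly_ring]
  show ?thesis by (simp add: E_def E_grading_def squares_ideal_def)
qed

lemma E_indet_homogeneous: "E_indet i \<in> E_grading (2 ^ i)"
  using indet_homogeneous by (auto simp: E_indet_def E_grading_def quotient_grading_def)

lemma graded_Q: "graded_ring Q Q_grading"
proof -
  have "E_indet i \<otimes>\<^bsub>E\<^esub> E_indet j \<in> E_grading (2 ^ i + 2 ^ j)" for i j
    using graded_E E_indet_homogeneous unfolding graded_ring_def by blast
  then have "{E_indet i \<otimes>\<^bsub>E\<^esub> E_indet j | i j. \<not> rado_edge i j} \<subseteq> (\<Union>n. E_grading n)"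
    by blast
  from homogeneous_Idl[OF graded_E this] graded_quotient[OF graded_E]
  show ?thesis by (simp add: Q_def Q_grading_def rado_ideal_def)
qed

end

theory Submission
  imports Defs
begin

text \<open>
  In \<open>E\<close> the squarefree monomials \<open>x\<^sub>C\<close>, for \<open>C\<close> a finite set of vertices, form a basis, and the Rado
  ideal kills exactly those for which \<open>C\<close> is not a clique. So \<open>Q\<close> has the basis \<open>x\<^sub>C\<close>, \<open>C\<close> a finite
  clique, with \<open>x\<^sub>C x\<^sub>D = x\<^sub>C\<^sub>\<union>\<^sub>D\<close> if \<open>C\<close> and \<open>D\<close> are disjoint with \<open>C \<union> D\<close> a clique, and \<open>x\<^sub>C x\<^sub>D = 0\<close>
  otherwise. The degree \<open>\<Sum>\<^bsub>i\<in>C\<^esub> 2\<^sup>i\<close> determines \<open>C\<close>, so a nonzero homogeneous element is a single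
  \<open>x\<^sub>C\<close>. Everything else follows from this description and from the extension property of the Rado
  graph: given disjoint finite vertex sets \<open>D\<close> and \<open>U\<close>, there are arbitrarily large vertices adjacent
  to all of \<open>D\<close> and to none of \<open>U\<close> (\<open>rado_extension\<close>).

  Total incoherence (\<open>finitely_presented_ideal_trivial\<close>). Let \<open>g\<close> map a finitely generated free
  module onto a proper ideal \<open>J\<close> with kernel generated by finitely many vectors \<open>z\<^sub>k\<close>. Choose a vertex
  \<open>v\<close> that occurs in no \<open>z\<^sub>k\<close> and is adjacent to no vertex that occurs in some \<open>g(e\<^sub>i)\<close>. As \<open>J\<close> is
  proper, no \<open>g(e\<^sub>i)\<close> has a constant term, so \<open>x\<^sub>v g(e\<^sub>i) = 0\<close> and \<open>x\<^sub>v e\<^sub>i\<close> is a combination of the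
  \<open>z\<^sub>k\<close>. Since \<open>v\<close> does not occur in the \<open>z\<^sub>k\<close>, comparing coefficients of \<open>x\<^sub>v\<close> gives a vector in the
  kernel with constant term \<open>e\<^sub>i\<close>. Hence \<open>J = \<mm> J\<close> for the augmentation ideal \<open>\<mm>\<close>, and looking at
  monomials of smallest size shows \<open>J = 0\<close>. That \<open>\<mm>\<close> is not finitely generated follows by comparing
  coefficients of \<open>x\<^sub>v\<close> for a vertex \<open>v\<close> outside finitely many would-be generators.

  Double annihilators (\<open>double_annihilator\<close>). If \<open>J\<close> is generated by \<open>x\<^sub>C\<^sub>1, \<dots>, x\<^sub>C\<^sub>r\<close> and \<open>x\<^sub>C \<notin> J\<close>,
  then no \<open>C\<^sub>i\<close> lies in \<open>C\<close>. A vertex \<open>v\<close> adjacent to all of \<open>C\<close> and to nothing in any \<open>C\<^sub>i - C\<close>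
  gives \<open>x\<^sub>v \<in> ann(J)\<close> with \<open>x\<^sub>v x\<^sub>C \<noteq> 0\<close>, so \<open>x\<^sub>C \<notin> ann\<^sup>2(J)\<close>.

  Self-injectivity fails (\<open>not_self_injective\<close>) because of the ideal \<open>(x\<^sub>0, x\<^sub>v)\<close> for a vertex \<open>v\<close> not
  adjacent to \<open>0\<close>. It is the direct sum of \<open>(x\<^sub>0)\<close> and \<open>(x\<^sub>v)\<close>, but the projection to the first
  summand is not multiplication by an element of \<open>Q\<close>. Finally \<open>a\<^sup>2\<close> is the constant term of \<open>a\<close>, since
  the characteristic is \<open>2\<close> (\<open>mult_self\<close>), so the nilradical is \<open>\<mm>\<close>.
\<close>

section \<open>Cliques and the Rado graph\<close>

text \<open>
  These rules turn arithmetic in \<open>\<F>\<close> into propositional logic; here the coefficients are to be treated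
  as elements of an arbitrary field, with characteristic \<open>2\<close> invoked explicitly where it matters.
\<close>
declare bit_not_zero_iff [simp del] bit_not_one_iff [simp del] add_bit_eq_xor [simp del]
  mult_bit_eq_and [simp del] minus_bit_def [simp del] uminus_bit_def [simp del]

definition clique :: "(nat \<Rightarrow> nat \<Rightarrow> bool) \<Rightarrow> nat set \<Rightarrow> bool" where
  "clique adj C \<longleftrightarrow> finite C \<and> (\<forall>i\<in>C. \<forall>j\<in>C. i \<noteq> j \<longrightarrow> adj i j)"

lemma clique_finite: "clique adj C \<Longrightarrow> finite C"
  by (simp add: clique_def)

lemma clique_subset: "clique adj C \<Longrightarrow> D \<subseteq> C \<Longrightarrow> clique adj D"
  unfolding clique_def by (meson finite_subset subsetD)

lemma clique_empty: "clique adj {}" and clique_singleton: "clique adj {i}"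
  by (simp_all add: clique_def)

lemma power_le_if_mem_B: "i \<in> B n \<Longrightarrow> 2 ^ i \<le> n"
proof -
  assume "i \<in> B n"
  then have "2 ^ i \<le> (\<Sum>j\<in>set_decode n. 2 ^ j :: nat)"
    unfolding B_eq_set_decode by (intro member_le_sum) auto
  also have "\<dots> = n" using set_decode_inverse[of n] by (simp add: set_encode_def)
  finally show ?thesis .
qed

lemma mem_B_less: "i \<in> B n \<Longrightarrow> i < n"
  using power_le_if_mem_B less_exp order_less_le_trans by blast

lemma rado_edge_sym: "rado_edge i j = rado_edge j i"
  by (auto simp: rado_edge_def)

text \<open>
  The witness has binary digits \<open>D \<union> {w}\<close> with \<open>w\<close> beyond all vertices in sight: the digits give the
  edges to \<open>D\<close>, and the extra digit makes the witness so large that it is a binary digit of none of the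
  given vertices, so it acquires no further edges.
\<close>
lemma rado_extension:
  assumes "finite D" "finite U" "D \<inter> U = {}"
  shows "\<exists>v>N. (\<forall>d\<in>D. rado_edge v d) \<and> (\<forall>u\<in>U. \<not> rado_edge v u)"
proof -
  obtain w where w: "\<forall>i\<in>insert N (D \<union> U). i < w"
    using assms finite_nat_set_iff_bounded[of "insert N (D \<union> U)"] by auto
  define v where "v = set_encode (insert w D)"
  have Bv: "B v = insert w D" using assms by (simp add: B_eq_set_decode v_def)
  have "w < v" using mem_B_less[of w v] by (simp add: Bv)
  then have less: "i < v" if "i \<in> insert N (D \<union> U)" for i using bspec[OF w that] \<open>w < v\<close> by linarith
  have "\<not> rado_edge v u" if "u \<in> U" for u
  proof -
    have "u \<notin> B v" using w assms that by (auto simp: Bv)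
    moreover have "v \<notin> B u" using mem_B_less[of v u] less[of u] that by auto
    ultimately show ?thesis by (simp add: rado_edge_def)
  qed
  moreover have "\<forall>d\<in>D. rado_edge v d" by (auto simp: rado_edge_def Bv)
  ultimately show ?thesis using less by blast
qed

section \<open>Squarefree monomials\<close>

definition squarefree_exp :: "nat set \<Rightarrow> nat \<Rightarrow>\<^sub>0 nat" where
  "squarefree_exp C = Abs_poly_mapping (\<lambda>i. of_bool (i \<in> C))"

lemma lookup_squarefree_exp:
  "finite C \<Longrightarrow> Poly_Mapping.lookup (squarefree_exp C) i = of_bool (i \<in> C)"
  by (simp add: squarefree_exp_def)

lemma keys_squarefree_exp: "finite C \<Longrightarrow> Poly_Mapping.keys (squarefree_exp C) = C"
  by (auto simp: in_keys_iff lookup_squarefree_exp)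

lemma squarefree_exp_inject:
  "finite C \<Longrightarrow> finite D \<Longrightarrow> squarefree_exp C = squarefree_exp D \<longleftrightarrow> C = D"
  using keys_squarefree_exp by metis

lemma squarefree_exp_empty: "squarefree_exp {} = 0"
  by (rule poly_mapping_eqI) (simp add: lookup_squarefree_exp)

lemma squarefree_exp_split:
  "finite C \<Longrightarrow> D \<subseteq> C \<Longrightarrow> squarefree_exp C = squarefree_exp D + squarefree_exp (C - D)"
  by (rule poly_mapping_eqI) (auto simp: lookup_squarefree_exp lookup_add finite_subset)

lemma squarefree_exp_summand:
  assumes "finite C" "squarefree_exp C = l + m"
  shows "\<exists>D\<subseteq>C. l = squarefree_exp D"
proof -
  have le: "Poly_Mapping.lookup l i \<le> of_bool (i \<in> C)" for i
    using arg_cong[OF assms(2), of "\<lambda>p. Poly_Mapping.lookup p i"]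
    by (simp add: lookup_squarefree_exp[OF assms(1)] lookup_add)
  have sub: "Poly_Mapping.keys l \<subseteq> C"
  proof
    fix i assume "i \<in> Poly_Mapping.keys l"
    then show "i \<in> C" using le[of i] by (cases "i \<in> C") (auto simp: in_keys_iff)
  qed
  moreover have "l = squarefree_exp (Poly_Mapping.keys l)"
  proof (rule poly_mapping_eqI)
    fix i show "Poly_Mapping.lookup l i = Poly_Mapping.lookup (squarefree_exp (Poly_Mapping.keys l)) i"
      using le[of i] by (auto simp: lookup_squarefree_exp in_keys_iff of_bool_def split: if_splits)
  qed
  ultimately show ?thesis by blast
qed

lemma exponent_degree_squarefree:
  "finite C \<Longrightarrow> exponent_degree (squarefree_exp C) = set_encode C"
  by (simp add: exponent_degree_def keys_squarefree_exp lookup_squarefree_exp set_encode_def)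

text \<open>
  Only the factorizations of \<open>x\<^sub>C\<close> contribute, and these are \<open>x\<^sub>C = x\<^sub>D x\<^bsub>C-D\<^esub>\<close>. This formula survives the
  passage to \<open>Q\<close>, as subsets of cliques are cliques.
\<close>
lemma lookup_mult_squarefree:
  fixes p q :: rado_poly
  assumes C: "finite C"
  shows "Poly_Mapping.lookup (p * q) (squarefree_exp C) =
    (\<Sum>D\<in>Pow C. Poly_Mapping.lookup p (squarefree_exp D) * Poly_Mapping.lookup q (squarefree_exp (C - D)))"
proof -
  define F where "F l = Poly_Mapping.lookup p l *
    (\<Sum>m. Poly_Mapping.lookup q m when squarefree_exp C = l + m)" for l
  have inner: "(\<Sum>m. Poly_Mapping.lookup q m when squarefree_exp C = squarefree_exp D + m)
     = Poly_Mapping.lookup q (squarefree_exp (C - D))" if "D \<subseteq> C" for D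
  proof -
    have "squarefree_exp C = squarefree_exp D + m \<longleftrightarrow> m = squarefree_exp (C - D)" for m
      using squarefree_exp_split[OF C that] by auto
    then show ?thesis by simp
  qed
  have "F l = 0" if "l \<notin> squarefree_exp ` Pow C" for l
  proof -
    have "squarefree_exp C \<noteq> l + m" for m
      using squarefree_exp_summand[OF C, of l m] that by blast
    then show ?thesis by (simp add: F_def)
  qed
  then have "{l. F l \<noteq> 0} \<subseteq> squarefree_exp ` Pow C" by blast
  then have "Sum_any F = sum F (squarefree_exp ` Pow C)"
    using C by (intro Sum_any.expand_superset) auto
  also have "\<dots> = (\<Sum>D\<in>Pow C. F (squarefree_exp D))"
    using C by (intro sum.reindex_cong[where l = squarefree_exp])
      (auto simp: inj_on_def squarefree_exp_inject finite_subset)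
  also have "\<dots> = (\<Sum>D\<in>Pow C. Poly_Mapping.lookup p (squarefree_exp D) * Poly_Mapping.lookup q (squarefree_exp (C - D)))"
    by (intro sum.cong) (auto simp: F_def inner)
  finally show ?thesis unfolding lookup_mult F_def .
qed

section \<open>The clique basis of the Rado algebra\<close>

definition rado_proj :: "rado_poly \<Rightarrow> rado_poly set set" where
  "rado_proj p = rado_ideal +>\<^bsub>E\<^esub> (squares_ideal +>\<^bsub>F_poly_ring\<^esub> p)"

lemma cring_E: "cring E" and cring_Q: "cring Q"
  using graded_E graded_Q by (simp_all add: graded_ring_def)

lemma ideal_squares: "ideal squares_ideal F_poly_ring"
proof -
  interpret cring F_poly_ring by (rule cring_poly_ring)
  show ?thesis unfolding squares_ideal_def by (rule genideal_ideal) (simp add: poly_ring_simps)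
qed

lemma E_proj_hom: "ring_hom_cring F_poly_ring E (\<lambda>p. squares_ideal +>\<^bsub>F_poly_ring\<^esub> p)"
  unfolding E_def using ideal.rcos_ring_hom_cring[OF ideal_squares cring_poly_ring] .

lemma E_indet_closed: "E_indet i \<in> carrier E"
  using ring_hom_cring.axioms(3)[OF E_proj_hom]
  by (auto simp: E_indet_def ring_hom_cring_axioms_def poly_ring_simps dest: ring_hom_closed)

lemma ideal_rado: "ideal rado_ideal E"
proof -
  interpret cring E by (rule cring_E)
  show ?thesis unfolding rado_ideal_def by (rule genideal_ideal) (auto simp: E_indet_closed)
qed

lemma Q_proj_hom: "ring_hom_cring E Q (\<lambda>x. rado_ideal +>\<^bsub>E\<^esub> x)"
  unfolding Q_def using ideal.rcos_ring_hom_cring[OF ideal_rado cring_E] .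

lemma rado_proj_hom:
  shows rado_proj_closed: "rado_proj p \<in> carrier Q"
    and rado_proj_add: "rado_proj (p + q) = rado_proj p \<oplus>\<^bsub>Q\<^esub> rado_proj q"
    and rado_proj_mult: "rado_proj (p * q) = rado_proj p \<otimes>\<^bsub>Q\<^esub> rado_proj q"
    and rado_proj_one: "rado_proj 1 = \<one>\<^bsub>Q\<^esub>"
    and rado_proj_zero: "rado_proj 0 = \<zero>\<^bsub>Q\<^esub>"
proof -
  interpret e: ring_hom_cring F_poly_ring E "\<lambda>p. squares_ideal +>\<^bsub>F_poly_ring\<^esub> p" by (rule E_proj_hom)
  interpret q: ring_hom_cring E Q "\<lambda>x. rado_ideal +>\<^bsub>E\<^esub> x" by (rule Q_proj_hom)
  note [simp] = poly_ring_simps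
  have [simp]: "x \<in> carrier F_poly_ring" for x by simp
  show "rado_proj p \<in> carrier Q" unfolding rado_proj_def by simp
  show "rado_proj (p + q) = rado_proj p \<oplus>\<^bsub>Q\<^esub> rado_proj q"
    unfolding rado_proj_def using e.hom_add[of p q] by simp
  show "rado_proj (p * q) = rado_proj p \<otimes>\<^bsub>Q\<^esub> rado_proj q"
    unfolding rado_proj_def using e.hom_mult[of p q] by simp
  show "rado_proj 1 = \<one>\<^bsub>Q\<^esub>" unfolding rado_proj_def using e.hom_one by simp
  show "rado_proj 0 = \<zero>\<^bsub>Q\<^esub>" unfolding rado_proj_def using e.hom_zero by simp
qed

lemma rado_proj_surj: "y \<in> carrier Q \<Longrightarrow> \<exists>p. y = rado_proj p"
  unfolding rado_proj_def by (metis E_def Q_def Quot_surj)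

text \<open>The span of the monomials that vanish in \<open>Q\<close>; it will turn out to be the kernel of \<^const>\<open>rado_proj\<close>.\<close>
definition clique_free_polys :: "rado_poly set" where
  "clique_free_polys = {p. \<forall>C. clique rado_edge C \<longrightarrow> Poly_Mapping.lookup p (squarefree_exp C) = 0}"

lemma ideal_clique_free: "ideal clique_free_polys F_poly_ring"
proof -
  interpret cring F_poly_ring by (rule cring_poly_ring)
  have inv: "\<ominus>\<^bsub>F_poly_ring\<^esub> a = - a" for a
    by (rule sum_zero_eq_neg[symmetric]) (auto simp: poly_ring_simps)
  have mult: "x * a \<in> clique_free_polys" if "a \<in> clique_free_polys" for a x
  proof -
    have "Poly_Mapping.lookup a (squarefree_exp (C - D)) = 0" if "clique rado_edge C" for C D
      using clique_subset[OF that, of "C - D"] \<open>a \<in> clique_free_polys\<close> by (auto simp: clique_free_polys_def)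
    then show ?thesis by (auto simp: clique_free_polys_def lookup_mult_squarefree clique_finite)
  qed
  show ?thesis
  proof (rule idealI)
    show "subgroup clique_free_polys (add_monoid F_poly_ring)"
    proof (rule add.subgroupI)
      show "clique_free_polys \<noteq> {}" by (auto simp: clique_free_polys_def intro!: exI[of _ 0])
    qed (auto simp: clique_free_polys_def inv poly_ring_simps lookup_add)
  qed (use mult in \<open>auto simp: poly_ring_simps ring_axioms mult.commute\<close>)
qed

lemma a_rcos_eq_zero_iff:
  assumes "ideal I R" "x \<in> carrier R"
  shows "I +>\<^bsub>R\<^esub> x = \<zero>\<^bsub>R Quot I\<^esub> \<longleftrightarrow> x \<in> I"
proof -
  interpret ideal I R by fact
  show ?thesis using a_rcos_self[OF assms(2)] a_rcos_const[of x] by (auto simp: FactRing_def)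
qed

lemma indet_square: "indet i ^ 2 = Poly_Mapping.single (Poly_Mapping.single i 2) 1"
proof -
  have "Poly_Mapping.single i 1 + Poly_Mapping.single i 1 = Poly_Mapping.single i (2::nat)"
    by (metis one_add_one single_add)
  then show ?thesis unfolding indet_def power2_eq_square mult_single by simp
qed

lemma square_clique_free: "indet i ^ 2 \<in> clique_free_polys"
proof -
  have "squarefree_exp C \<noteq> Poly_Mapping.single i 2" if "finite C" for C
  proof
    assume "squarefree_exp C = Poly_Mapping.single i 2"
    then have "of_bool (i \<in> C) = (2::nat)" using lookup_squarefree_exp[OF that, of i] by simp
    then show False by (cases "i \<in> C") auto
  qed
  then show ?thesis
    unfolding indet_square clique_free_polys_def
    by (simp add: lookup_single when_def clique_finite) (metis clique_finite)
qed

lemma nonedge_clique_free: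
  assumes "\<not> rado_edge i j"
  shows "indet i * indet j \<in> clique_free_polys"
proof (cases "i = j")
  case True
  then show ?thesis using square_clique_free[of i] by (simp add: power2_eq_square)
next
  case False
  have "\<not> clique rado_edge C" if "squarefree_exp C = Poly_Mapping.single i 1 + Poly_Mapping.single j 1" for C
  proof
    assume C: "clique rado_edge C"
    have "i \<in> C" "j \<in> C"
      using keys_squarefree_exp[OF clique_finite[OF C]] False unfolding that
      by (auto simp: in_keys_iff lookup_add lookup_single)
    then show False using C assms False by (auto simp: clique_def)
  qed
  then show ?thesis
    by (auto simp: clique_free_polys_def indet_def mult_single lookup_single when_def)
qed

text \<open>
  Both ideals that are factored out lie in the span of the non-clique monomials because that span is
  an ideal containing their generators. Conversely, a monomial that is not of the form \<open>x\<^sub>C\<close> for a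
  clique \<open>C\<close> is divisible either by a square \<open>x\<^sub>i\<^sup>2\<close> or by \<open>x\<^sub>i x\<^sub>j\<close> for a non-edge.
\<close>
lemma rado_proj_zero_iff: "rado_proj p = \<zero>\<^bsub>Q\<^esub> \<longleftrightarrow> p \<in> clique_free_polys"
proof
  let ?e = "\<lambda>p. squares_ideal +>\<^bsub>F_poly_ring\<^esub> p"
  interpret P: cring F_poly_ring by (rule cring_poly_ring)
  interpret e: ring_hom_cring F_poly_ring E ?e by (rule E_proj_hom)
  interpret q: ring_hom_cring E Q "\<lambda>x. rado_ideal +>\<^bsub>E\<^esub> x" by (rule Q_proj_hom)
  interpret K: ideal clique_free_polys F_poly_ring by (rule ideal_clique_free)
  have cE: "?e p \<in> carrier E" for p by (rule e.hom_closed) (simp add: poly_ring_simps)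
  have e_zero: "?e p = \<zero>\<^bsub>E\<^esub> \<longleftrightarrow> p \<in> squares_ideal" for p
    unfolding E_def by (rule a_rcos_eq_zero_iff[OF ideal_squares]) (simp add: poly_ring_simps)
  have e_mult: "?e p \<otimes>\<^bsub>E\<^esub> ?e q = ?e (p * q)" for p q
    using e.hom_mult[of p q] by (simp add: poly_ring_simps)
  have q_zero: "rado_proj p = \<zero>\<^bsub>Q\<^esub> \<longleftrightarrow> ?e p \<in> rado_ideal" for p
    unfolding rado_proj_def Q_def by (rule a_rcos_eq_zero_iff[OF ideal_rado cE])
  {
    assume "rado_proj p = \<zero>\<^bsub>Q\<^esub>"
    have sq: "squares_ideal \<subseteq> clique_free_polys"
      unfolding squares_ideal_def using square_clique_free
      by (intro P.genideal_minimal ideal_clique_free) auto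
    have "ideal (?e ` clique_free_polys) E"
      unfolding E_def by (rule P.ring_ideal_imp_quot_ideal[OF ideal_squares ideal_clique_free])
    then have "rado_ideal \<subseteq> ?e ` clique_free_polys"
      unfolding rado_ideal_def using nonedge_clique_free
      by (intro e.S.genideal_minimal) (auto simp: E_indet_def e_mult)
    then obtain p' where p': "p' \<in> clique_free_polys" "?e p = ?e p'"
      using \<open>rado_proj p = \<zero>\<^bsub>Q\<^esub>\<close> q_zero by auto
    have "?e p = ?e (p - p') \<oplus>\<^bsub>E\<^esub> ?e p'"
      using e.hom_add[of "p - p'" p'] by (simp add: poly_ring_simps)
    then have "?e (p - p') = \<zero>\<^bsub>E\<^esub>" using p'(2) cE by (metis e.S.add.l_cancel_one e.S.add.m_comm)
    then have "p - p' \<in> clique_free_polys" using e_zero sq by auto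
    then show "p \<in> clique_free_polys" using p' K.a_closed[of "p - p'" p'] by (simp add: poly_ring_simps)
  next
    assume p: "p \<in> clique_free_polys"
    have mult_zero: "rado_proj (a * b) = \<zero>\<^bsub>Q\<^esub>" if "rado_proj a = \<zero>\<^bsub>Q\<^esub>" for a b
      using that rado_proj_closed by (simp add: rado_proj_mult)
    have mono: "rado_proj (Poly_Mapping.single m (Poly_Mapping.lookup p m)) = \<zero>\<^bsub>Q\<^esub>"
      if m: "m \<in> Poly_Mapping.keys p" for m
    proof (cases "\<exists>i. Poly_Mapping.lookup m i \<ge> 2")
      case True
      then obtain i where i: "Poly_Mapping.lookup m i \<ge> 2" by blast
      have "m = Poly_Mapping.single i 2 + (m - Poly_Mapping.single i 2)"
        using i by (intro poly_mapping_eqI) (auto simp: lookup_add lookup_minus lookup_single when_def)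
      then have "Poly_Mapping.single m (Poly_Mapping.lookup p m)
          = indet i ^ 2 * Poly_Mapping.single (m - Poly_Mapping.single i 2) (Poly_Mapping.lookup p m)"
        by (simp add: indet_square mult_single)
      moreover have "rado_proj (indet i ^ 2) = \<zero>\<^bsub>Q\<^esub>"
      proof -
        have "indet i ^ 2 \<in> squares_ideal"
          unfolding squares_ideal_def by (rule set_mp[OF P.genideal_self]) (auto simp: poly_ring_simps)
        then have "?e (indet i ^ 2) = \<zero>\<^bsub>E\<^esub>" using e_zero by blast
        then show ?thesis unfolding rado_proj_def by simp
      qed
      ultimately show ?thesis by (simp add: mult_zero)
    next
      case False
      let ?C = "Poly_Mapping.keys m"
      have *: "m = squarefree_exp ?C"
      proof (rule poly_mapping_eqI)
        fix i
        have "Poly_Mapping.lookup m i \<le> 1" using False by (metis Suc_1 Suc_eq_plus1 not_less_eq_eq plus_1_eq_Suc)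
        then show "Poly_Mapping.lookup m i = Poly_Mapping.lookup (squarefree_exp ?C) i"
          by (auto simp: lookup_squarefree_exp in_keys_iff)
      qed
      then have "\<not> clique rado_edge ?C" using p m by (auto simp: clique_free_polys_def in_keys_iff)
      then obtain i j where ij: "i \<in> ?C" "j \<in> ?C" "i \<noteq> j" "\<not> rado_edge i j" by (auto simp: clique_def)
      define r where "r = m - (Poly_Mapping.single i 1 + Poly_Mapping.single j 1)"
      have "m = Poly_Mapping.single i 1 + Poly_Mapping.single j 1 + r"
        unfolding r_def using ij
        by (intro poly_mapping_eqI) (auto simp: lookup_add lookup_minus lookup_single when_def in_keys_iff)
      then have "Poly_Mapping.single m (Poly_Mapping.lookup p m)
          = indet i * indet j * Poly_Mapping.single r (Poly_Mapping.lookup p m)"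
        by (simp add: indet_def mult_single)
      moreover have "rado_proj (indet i * indet j) = \<zero>\<^bsub>Q\<^esub>"
      proof -
        have "E_indet i \<otimes>\<^bsub>E\<^esub> E_indet j \<in> rado_ideal"
          unfolding rado_ideal_def
          by (rule set_mp[OF e.S.genideal_self]) (use ij E_indet_closed in auto)
        then show ?thesis by (simp add: q_zero E_indet_def e_mult)
      qed
      ultimately show ?thesis by (simp add: mult_zero)
    qed
    have "rado_proj (sum f A) = \<zero>\<^bsub>Q\<^esub>" if "finite A" "\<And>m. m \<in> A \<Longrightarrow> rado_proj (f m) = \<zero>\<^bsub>Q\<^esub>"
      for f and A :: "(nat \<Rightarrow>\<^sub>0 nat) set"
      using that by (induction A) (auto simp: rado_proj_zero rado_proj_add)
    moreover have "p = (\<Sum>m\<in>Poly_Mapping.keys p. Poly_Mapping.single m (Poly_Mapping.lookup p m))"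
      by (rule poly_mapping_eqI) (simp add: lookup_sum lookup_single when_def in_keys_iff)
    ultimately show "rado_proj p = \<zero>\<^bsub>Q\<^esub>" using mono by (metis (no_types, lifting) finite_keys)
  }
qed

text \<open>
  The value on a clique is independent of the chosen representative by the description of the kernel
  (see \<open>rado_coeff_proj\<close>). Other index sets get the value \<open>0\<close>, so that an element of \<open>Q\<close> is
  determined by its coefficient function.
\<close>
definition rado_coeff :: "rado_poly set set \<Rightarrow> nat set \<Rightarrow> bit" where
  "rado_coeff y C = (if clique rado_edge C
     then Poly_Mapping.lookup (SOME p. rado_proj p = y) (squarefree_exp C) else 0)"

lemma rado_proj_eq_iff:
  "rado_proj p = rado_proj q \<longleftrightarrow>
    (\<forall>C. clique rado_edge C \<longrightarrow>
      Poly_Mapping.lookup p (squarefree_exp C) = Poly_Mapping.lookup q (squarefree_exp C))"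
proof -
  interpret cring Q by (rule cring_Q)
  have "rado_proj p = rado_proj (p - q) \<oplus>\<^bsub>Q\<^esub> rado_proj q"
    by (simp flip: rado_proj_add)
  then have "rado_proj p = rado_proj q \<longleftrightarrow> rado_proj (p - q) = \<zero>\<^bsub>Q\<^esub>"
    using rado_proj_closed by (metis add.r_cancel_one' l_zero)
  then show ?thesis
    unfolding rado_proj_zero_iff clique_free_polys_def lookup_minus mem_Collect_eq right_minus_eq .
qed

lemma rado_coeff_proj:
  "rado_coeff (rado_proj p) C =
    (if clique rado_edge C then Poly_Mapping.lookup p (squarefree_exp C) else 0)"
proof -
  have "rado_proj (SOME q. rado_proj q = rado_proj p) = rado_proj p" by (rule someI) simp
  then show ?thesis unfolding rado_coeff_def rado_proj_eq_iff by simp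
qed

lemma rado_coeff_eqI:
  assumes "x \<in> carrier Q" "y \<in> carrier Q" "rado_coeff x = rado_coeff y"
  shows "x = y"
proof -
  obtain p q where pq: "x = rado_proj p" "y = rado_proj q" using assms rado_proj_surj by meson
  show ?thesis
    using fun_cong[OF assms(3)] unfolding pq rado_proj_eq_iff rado_coeff_proj by metis
qed

lemma rado_coeff_finite:
  assumes "x \<in> carrier Q" shows "finite {C. rado_coeff x C \<noteq> 0}"
proof -
  obtain p where p: "x = rado_proj p" using assms rado_proj_surj by meson
  have "{C. rado_coeff x C \<noteq> 0} \<subseteq> Poly_Mapping.keys ` Poly_Mapping.keys p"
  proof
    fix C assume "C \<in> {C. rado_coeff x C \<noteq> 0}"
    then have "finite C" "squarefree_exp C \<in> Poly_Mapping.keys p"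
      by (auto simp: p rado_coeff_proj clique_finite in_keys_iff split: if_splits)
    then show "C \<in> Poly_Mapping.keys ` Poly_Mapping.keys p"
      by (intro image_eqI[of _ _ "squarefree_exp C"]) (simp_all add: keys_squarefree_exp)
  qed
  then show ?thesis by (rule finite_subset) simp
qed

lemma rado_coeff_add:
  "x \<in> carrier Q \<Longrightarrow> y \<in> carrier Q \<Longrightarrow> rado_coeff (x \<oplus>\<^bsub>Q\<^esub> y) C = rado_coeff x C + rado_coeff y C"
  using rado_proj_surj[of x] rado_proj_surj[of y]
  by (metis (no_types) add_0 lookup_add rado_coeff_proj rado_proj_add)

lemma rado_coeff_mult:
  assumes "x \<in> carrier Q" "y \<in> carrier Q" "clique rado_edge C"
  shows "rado_coeff (x \<otimes>\<^bsub>Q\<^esub> y) C = (\<Sum>D\<in>Pow C. rado_coeff x D * rado_coeff y (C - D))"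
proof -
  obtain p q where pq: "x = rado_proj p" "y = rado_proj q" using assms rado_proj_surj by meson
  have "clique rado_edge D" "clique rado_edge (C - D)" if "D \<in> Pow C" for D
    using that clique_subset[OF assms(3)] by auto
  then show ?thesis
    using assms(3) lookup_mult_squarefree[OF clique_finite[OF assms(3)]]
    by (simp add: pq rado_coeff_proj flip: rado_proj_mult)
qed

lemma rado_coeff_one: "rado_coeff \<one>\<^bsub>Q\<^esub> C = of_bool (C = {})"
proof -
  have "squarefree_exp C = 0 \<longleftrightarrow> C = {}" if "finite C"
    using squarefree_exp_inject[OF that, of "{}"] by (simp add: squarefree_exp_empty)
  then show ?thesis
    by (auto simp: rado_coeff_proj clique_finite clique_empty lookup_one when_def simp flip: rado_proj_one)
qed

text \<open>
  The second conclusion bounds the monomials of the representative; it provides a homogeneous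
  representative for an element whose coefficients sit in one degree.
\<close>
lemma rado_coeff_realize:
  fixes \<phi> :: "nat set \<Rightarrow> bit"
  assumes fin: "finite {C. \<phi> C \<noteq> 0}" and cl: "\<And>C. \<phi> C \<noteq> 0 \<Longrightarrow> clique rado_edge C"
  defines "p \<equiv> \<Sum>C\<in>{C. \<phi> C \<noteq> 0}. Poly_Mapping.single (squarefree_exp C) (\<phi> C)"
  shows "rado_coeff (rado_proj p) = \<phi>" "Poly_Mapping.keys p \<subseteq> squarefree_exp ` {C. \<phi> C \<noteq> 0}"
proof -
  have cl_fin: "\<phi> C \<noteq> 0 \<Longrightarrow> finite C" for C using cl clique_finite by blast
  have "Poly_Mapping.lookup p (squarefree_exp D) = \<phi> D" if "finite D" for D
  proof -
    have "Poly_Mapping.lookup p (squarefree_exp D) = (\<Sum>C\<in>{C. \<phi> C \<noteq> 0}. if C = D then \<phi> D else 0)"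
      unfolding p_def lookup_sum
      using cl that by (intro sum.cong) (auto simp: lookup_single when_def squarefree_exp_inject cl_fin)
    then show ?thesis using fin by auto
  qed
  then show "rado_coeff (rado_proj p) = \<phi>"
    using cl by (fastforce simp: rado_coeff_proj clique_finite)
  show "Poly_Mapping.keys p \<subseteq> squarefree_exp ` {C. \<phi> C \<noteq> 0}"
  proof (rule subsetI, rule ccontr)
    fix m assume m: "m \<in> Poly_Mapping.keys p" "m \<notin> squarefree_exp ` {C. \<phi> C \<noteq> 0}"
    have "Poly_Mapping.lookup p m = 0"
      unfolding p_def lookup_sum using m(2) by (intro sum.neutral) (auto simp: lookup_single when_def)
    then show False using m(1) by (simp add: in_keys_iff)
  qed
qed

lemma Q_grading_iff:
  "x \<in> Q_grading n \<longleftrightarrow>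
     x \<in> carrier Q \<and> (\<forall>C. rado_coeff x C \<noteq> 0 \<longrightarrow> int (set_encode C) = n)"
proof -
  have img: "Q_grading n = rado_proj ` poly_grading n"
    by (simp add: Q_grading_def E_grading_def quotient_grading_def rado_proj_def image_image)
  show ?thesis
  proof
    assume "x \<in> Q_grading n"
    then obtain p where "p \<in> poly_grading n" "x = rado_proj p" unfolding img by blast
    moreover have "int (set_encode C) = n" if "rado_coeff (rado_proj p) C \<noteq> 0" for C
    proof -
      have "finite C" "squarefree_exp C \<in> Poly_Mapping.keys p"
        using that by (simp_all add: rado_coeff_proj in_keys_iff clique_finite split: if_splits)
      then show ?thesis
        using \<open>p \<in> poly_grading n\<close> exponent_degree_squarefree by (auto simp: poly_grading_def)
    qed
    ultimately show "x \<in> carrier Q \<and> (\<forall>C. rado_coeff x C \<noteq> 0 \<longrightarrow> int (set_encode C) = n)"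
      by (simp add: rado_proj_closed)
  next
    assume x: "x \<in> carrier Q \<and> (\<forall>C. rado_coeff x C \<noteq> 0 \<longrightarrow> int (set_encode C) = n)"
    then have cl: "clique rado_edge C" if "rado_coeff x C \<noteq> 0" for C
      using that by (auto simp: rado_coeff_def split: if_splits)
    define p where "p = (\<Sum>C\<in>{C. rado_coeff x C \<noteq> 0}. Poly_Mapping.single (squarefree_exp C) (rado_coeff x C))"
    note p = rado_coeff_realize[OF rado_coeff_finite cl, of x, folded p_def]
    have "p \<in> poly_grading n"
      unfolding poly_grading_def using p(2) x cl by (force simp: exponent_degree_squarefree clique_finite)
    moreover have "x = rado_proj p"
      using p(1) x by (intro rado_coeff_eqI) (auto simp: rado_proj_closed)
    ultimately show "x \<in> Q_grading n" unfolding img by blast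
  qed
qed

section \<open>Graded algebras with a clique basis\<close>

lemma bit_double: "(x::bit) + x = 0"
  using bit_2_eq_0 by (metis mult_2 mult_zero_left)

lemma bit_one_if: "(x::bit) \<noteq> 0 \<Longrightarrow> x = 1"
  by (cases x) auto

lemma (in cring) ideal_ann:
  assumes "J \<subseteq> carrier R"
  shows "ideal (ann R J) R"
proof -
  have J: "b \<in> carrier R" if "b \<in> J" for b using assms that by auto
  show ?thesis
  proof (rule idealI)
    show "subgroup (ann R J) (add_monoid R)"
      by (rule add.subgroupI) (auto simp: ann_def J l_distr l_minus intro!: exI[of _ \<zero>])
    fix a x assume a: "a \<in> ann R J" "x \<in> carrier R"
    then show "x \<otimes> a \<in> ann R J" by (auto simp: ann_def J m_assoc)
    then show "a \<otimes> x \<in> ann R J" using a by (simp add: m_comm ann_def)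
  qed (rule ring_axioms)
qed

text \<open>What kills the generators kills the ideal, since the elements killed by \<open>x\<close> form an ideal.\<close>
lemma (in cring) ann_genideal:
  assumes "x \<in> carrier R" "S \<subseteq> carrier R" "\<And>s. s \<in> S \<Longrightarrow> x \<otimes> s = \<zero>"
  shows "x \<in> ann R (Idl S)"
proof -
  have "S \<subseteq> ann R {x}" using assms m_comm[of x] by (auto simp: ann_def subset_iff)
  then have "Idl S \<subseteq> ann R {x}" using assms by (intro genideal_minimal ideal_ann) auto
  then show ?thesis using assms(1) m_comm[of x] by (auto simp: ann_def subset_iff)
qed

text \<open>
  The locale collects all that the rest of the argument uses about \<open>Q\<close>. Its elements are identified
  with finitely supported coefficient functions on cliques, and the graph has the extension property.
\<close>
locale clique_algebra = cring R for R :: "('a, 'c) ring_scheme" (structure) +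
  fixes G :: "int \<Rightarrow> 'a set" and adj :: "nat \<Rightarrow> nat \<Rightarrow> bool" and coeff :: "'a \<Rightarrow> nat set \<Rightarrow> bit"
  assumes adj_sym: "adj i j = adj j i"
    and adj_extension: "finite D \<Longrightarrow> finite U \<Longrightarrow> D \<inter> U = {} \<Longrightarrow>
      \<exists>v>N. (\<forall>d\<in>D. adj v d) \<and> (\<forall>u\<in>U. \<not> adj v u)"
    and coeff_eqI: "a \<in> carrier R \<Longrightarrow> b \<in> carrier R \<Longrightarrow> coeff a = coeff b \<Longrightarrow> a = b"
    and coeff_finite: "a \<in> carrier R \<Longrightarrow> finite {C. coeff a C \<noteq> 0}"
    and coeff_clique: "a \<in> carrier R \<Longrightarrow> coeff a C \<noteq> 0 \<Longrightarrow> clique adj C"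
    and coeff_realize: "finite {C. \<phi> C \<noteq> 0} \<Longrightarrow> (\<And>C. \<phi> C \<noteq> 0 \<Longrightarrow> clique adj C) \<Longrightarrow>
      \<exists>a\<in>carrier R. coeff a = \<phi>"
    and coeff_add: "a \<in> carrier R \<Longrightarrow> b \<in> carrier R \<Longrightarrow> coeff (a \<oplus> b) C = coeff a C + coeff b C"
    and coeff_one: "coeff \<one> C = of_bool (C = {})"
    and coeff_mult: "a \<in> carrier R \<Longrightarrow> b \<in> carrier R \<Longrightarrow> clique adj C \<Longrightarrow>
      coeff (a \<otimes> b) C = (\<Sum>D\<in>Pow C. coeff a D * coeff b (C - D))"
    and graded: "graded_ring R G"
    and grading_iff: "a \<in> G n \<longleftrightarrow> a \<in> carrier R \<and> (\<forall>C. coeff a C \<noteq> 0 \<longrightarrow> int (set_encode C) = n)"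
begin

lemma coeff_zero: "coeff \<zero> C = 0"
  using coeff_add[of \<zero> \<zero> C] by simp

lemma coeff_minus: "a \<in> carrier R \<Longrightarrow> coeff (\<ominus> a) C = coeff a C"
  using coeff_add[of "\<ominus> a" a C]
  by (simp add: l_neg coeff_zero) (metis add_right_cancel bit_double)

lemma coeff_nonclique: "a \<in> carrier R \<Longrightarrow> \<not> clique adj C \<Longrightarrow> coeff a C = 0"
  using coeff_clique by blast

lemma zero_if_coeff_zero: "a \<in> carrier R \<Longrightarrow> (\<And>C. coeff a C = 0) \<Longrightarrow> a = \<zero>"
  by (rule coeff_eqI) (auto simp: coeff_zero)

lemma homogeneous_carrier: "a \<in> G n \<Longrightarrow> a \<in> carrier R"
  by (simp add: grading_iff)

lemma homogeneous_whole_ring: "homogeneous_ideal R G (carrier R)"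
  using homogeneous_Idl[OF graded, of "{\<one>}"] by (auto simp: grading_iff coeff_one genideal_one)

lemma homogeneous_zero_ideal: "homogeneous_ideal R G {\<zero>}"
  using homogeneous_Idl[OF graded, of "{\<zero>}"] by (auto simp: grading_iff coeff_zero genideal_zero)

definition mon :: "nat set \<Rightarrow> 'a" where
  "mon C = (SOME a. a \<in> carrier R \<and> coeff a = (\<lambda>D. of_bool (D = C)))"

lemma
  assumes "clique adj C"
  shows mon_closed: "mon C \<in> carrier R" and coeff_mon: "coeff (mon C) D = of_bool (D = C)"
proof -
  have "\<exists>a. a \<in> carrier R \<and> coeff a = (\<lambda>D. of_bool (D = C))"
    using coeff_realize[of "\<lambda>D. of_bool (D = C)"] assms by fastforce
  from someI_ex[OF this] show "mon C \<in> carrier R" "coeff (mon C) D = of_bool (D = C)"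
    by (simp_all add: mon_def)
qed

lemma coeff_mon_mult:
  assumes C: "clique adj C" and a: "a \<in> carrier R"
  shows "coeff (mon C \<otimes> a) D = (if clique adj D \<and> C \<subseteq> D then coeff a (D - C) else 0)"
proof (cases "clique adj D")
  case True
  have "coeff (mon C \<otimes> a) D = (\<Sum>K\<in>Pow D. if K = C then coeff a (D - C) else 0)"
    unfolding coeff_mult[OF mon_closed[OF C] a True] by (intro sum.cong) (auto simp: coeff_mon[OF C])
  also have "\<dots> = (if C \<in> Pow D then coeff a (D - C) else 0)"
    using True by (intro sum.delta) (simp add: clique_finite)
  finally show ?thesis using True by simp
next
  case False
  then show ?thesis using coeff_nonclique mon_closed[OF C] a by simp
qed

lemma mon_homogeneous: "clique adj C \<Longrightarrow> mon C \<in> G (int (set_encode C))"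
  by (auto simp: grading_iff mon_closed coeff_mon)

text \<open>Different finite sets have different binary encodings, so each degree contains at most one monomial.\<close>
lemma homogeneous_eq_mon:
  assumes "a \<in> G n" "coeff a C \<noteq> 0"
  shows "a = mon C"
proof (rule coeff_eqI)
  show aR: "a \<in> carrier R" using assms homogeneous_carrier by blast
  have C: "clique adj C" by (rule coeff_clique[OF aR assms(2)])
  then show "mon C \<in> carrier R" by (rule mon_closed)
  have "D = C" if "coeff a D \<noteq> 0" for D
  proof -
    have "int (set_encode D) = n" "int (set_encode C) = n" using assms that by (auto simp: grading_iff)
    then have "set_encode D = set_encode C" by linarith
    then show ?thesis using set_encode_eq clique_finite C coeff_clique[OF aR that] by blast
  qed
  then show "coeff a = coeff (mon C)"
    using bit_one_if[OF assms(2)] by (intro ext) (auto simp: coeff_mon[OF C])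
qed

lemma mon_factor:
  assumes "clique adj C" "D \<subseteq> C"
  shows "mon D \<otimes> mon (C - D) = mon C"
proof -
  have D: "clique adj D" "clique adj (C - D)" using assms clique_subset by blast+
  have "K - D = C - D \<and> D \<subseteq> K \<longleftrightarrow> K = C" for K using assms(2) by auto
  then show ?thesis using assms(1)
    by (intro coeff_eqI ext) (auto simp: mon_closed D coeff_mon_mult coeff_mon)
qed

text \<open>
  The monomials of \<open>a\<close> are removed one at a time. As the only nonzero coefficient is \<open>1\<close> and \<open>1 + 1 = 0\<close>,
  adding a monomial of \<open>a\<close> removes it.
\<close>
lemma mem_ideal_if_monomials:
  assumes J: "ideal J R" and a: "a \<in> carrier R" and mons: "\<And>C. coeff a C \<noteq> 0 \<Longrightarrow> mon C \<in> J"
  shows "a \<in> J"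
proof -
  interpret ideal J R by fact
  have "b \<in> J" if "finite A" "b \<in> carrier R" "{C. coeff b C \<noteq> 0} \<subseteq> A"
    "\<And>C. clique adj C \<Longrightarrow> C \<in> A \<Longrightarrow> mon C \<in> J" for A b
    using that
  proof (induction A arbitrary: b)
    case empty
    then have "b = \<zero>" by (intro zero_if_coeff_zero) auto
    then show ?case by simp
  next
    case (insert C A)
    show ?case
    proof (cases "coeff b C = 0")
      case True
      then have "{C. coeff b C \<noteq> 0} \<subseteq> A" using insert.prems(2) by blast
      then show ?thesis by (rule insert.IH[OF insert.prems(1)]) (simp add: insert.prems(3))
    next
      case False
      then have C: "clique adj C" using coeff_clique insert.prems by blast
      have m: "mon C \<in> carrier R" "mon C \<in> J" using C insert.prems by (auto simp: mon_closed)
      have "coeff (b \<oplus> mon C) D = (if D = C then 0 else coeff b D)" for D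
        using insert.prems(1) m bit_one_if[OF False] by (auto simp: coeff_add coeff_mon[OF C] bit_double)
      then have supp: "{D. coeff (b \<oplus> mon C) D \<noteq> 0} \<subseteq> A"
        using insert.prems(2) by (simp only: if_cancel simp_thms split: if_split) blast
      have "b \<oplus> mon C \<in> J"
        by (rule insert.IH[OF add.m_closed[OF insert.prems(1) m(1)] supp]) (simp add: insert.prems(3))
      then have "b \<oplus> mon C \<oplus> \<ominus> mon C \<in> J" using m by simp
      moreover have "b \<oplus> mon C \<oplus> \<ominus> mon C = b" using insert.prems(1) m by (simp add: a_assoc r_neg)
      ultimately show ?thesis by simp
    qed
  qed
  from this[OF coeff_finite[OF a] a subset_refl] show ?thesis using mons by blast
qed

text \<open>
  A monomial of a product contains a monomial of each factor. So one may prescribe vanishing on any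
  family of sets that is closed under subsets. With the family \<open>{{}}\<close> this is the augmentation ideal;
  with \<open>{{}, {v}}\<close> it is the ideal of elements without constant term and without \<open>x\<^sub>v\<close>.
\<close>
lemma ideal_vanishing:
  assumes down: "\<And>C D. C \<in> \<D> \<Longrightarrow> D \<subseteq> C \<Longrightarrow> D \<in> \<D>"
  shows "ideal {a \<in> carrier R. \<forall>C\<in>\<D>. coeff a C = 0} R" (is "ideal ?I R")
proof (rule idealI)
  show "subgroup ?I (add_monoid R)"
    by (rule add.subgroupI) (auto simp: coeff_zero coeff_add coeff_minus intro!: exI[of _ \<zero>])
  fix a x assume a: "a \<in> ?I" "x \<in> carrier R"
  have "coeff (x \<otimes> a) C = 0" if "C \<in> \<D>" for C
  proof (cases "clique adj C")
    case True
    have "coeff a (C - D) = 0" for D using a down[OF that, of "C - D"] by auto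
    then show ?thesis using a True by (simp add: coeff_mult)
  qed (use a coeff_nonclique in simp)
  then show "x \<otimes> a \<in> ?I" using a by auto
  then show "a \<otimes> x \<in> ?I" using a by (simp add: m_comm)
qed (rule ring_axioms)

text \<open>In characteristic \<open>2\<close> squaring is additive, and \<open>x\<^sub>C\<^sup>2 = 0\<close> unless \<open>C\<close> is empty.\<close>
lemma mult_self:
  assumes a: "a \<in> carrier R"
  shows "a \<otimes> a = (if coeff a {} = 0 then \<zero> else \<one>)"
proof -
  have "coeff (a \<otimes> a) C = of_bool (C = {}) * coeff a {}" for C
  proof (cases "clique adj C")
    case True
    show ?thesis
    proof (cases "C = {}")
      case True
      then show ?thesis using a coeff_mult[OF a a clique_empty] by (cases "coeff a {}") auto
    next
      case False
      then obtain c where c: "c \<in> C" by blast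
      \<comment> \<open>Complementation in \<open>C\<close> pairs off the summands: it exchanges the sets that contain \<open>c\<close> with
        those that do not, so each product occurs twice and the sum vanishes.\<close>
      let ?f = "\<lambda>D. coeff a D * coeff a (C - D)"
      have fin: "finite (Pow C)" using True by (simp add: clique_finite)
      have "coeff (a \<otimes> a) C = sum ?f (Pow C)" by (rule coeff_mult[OF a a True])
      also have "\<dots> = sum ?f {D \<in> Pow C. c \<in> D} + sum ?f {D \<in> Pow C. c \<notin> D}"
        using fin by (subst sum.union_disjoint[symmetric]) (auto intro!: sum.cong)
      also have "sum ?f {D \<in> Pow C. c \<notin> D} = sum ?f {D \<in> Pow C. c \<in> D}"
        using c by (intro sum.reindex_bij_witness[of _ "\<lambda>D. C - D" "\<lambda>D. C - D"])
          (auto simp: double_diff mult.commute)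
      finally show ?thesis using False by (simp add: bit_double)
    qed
  next
    case False
    then show ?thesis using coeff_nonclique a clique_empty by auto
  qed
  then show ?thesis
    using a bit_one_if[of "coeff a {}"] by (intro coeff_eqI ext) (auto simp: coeff_zero coeff_one)
qed

text \<open>An element with nonzero constant term is its own inverse, as its square is \<open>1\<close>.\<close>
lemma ideal_whole_if_constant_coeff:
  assumes "ideal J R" "a \<in> J" "coeff a {} \<noteq> 0"
  shows "J = carrier R"
proof -
  interpret ideal J R by fact
  have a: "a \<in> carrier R" using assms(2) by (rule Icarr)
  have "a \<otimes> a \<in> J" using assms(2) a by (rule I_l_closed)
  then have "\<one> \<in> J" using mult_self[OF a] assms(3) by simp
  then show ?thesis by (rule one_imp_carrier)
qed

lemma nilradical_eq: "nilradical R = {a \<in> carrier R. coeff a {} = 0}"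
proof -
  have "coeff (a [^] (n::nat)) {} \<noteq> 0" if "a \<in> carrier R" "coeff a {} \<noteq> 0" for a n
    using that by (induction n) (simp_all add: coeff_one coeff_mult clique_empty)
  then have "coeff a {} = 0" if "a \<in> carrier R" "a [^] (n::nat) = \<zero>" for a n
    using that coeff_zero by metis
  moreover have "a [^] (2::nat) = \<zero>" if "a \<in> carrier R" "coeff a {} = 0" for a
    using that mult_self by (simp add: numeral_2_eq_2)
  ultimately show ?thesis unfolding nilradical_def by blast
qed

text \<open>The constant term is a surjective ring homomorphism to \<open>\<F>\<close> whose kernel is the nilradical.\<close>
lemma reduced_quotient:
  "graded_ring_iso (R Quot nilradical R) (quotient_grading R G (nilradical R))
     field_two field_two_grading \<noteq> {}"
proof -
  have F: "cring field_two" "carrier field_two = UNIV" "\<zero>\<^bsub>field_two\<^esub> = 0" "\<one>\<^bsub>field_two\<^esub> = 1"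
    "x \<oplus>\<^bsub>field_two\<^esub> y = x + y" "x \<otimes>\<^bsub>field_two\<^esub> y = x * y" for x y
    by (auto simp: field_two_def ring_of_type_algebra_def intro: cring_from_type_algebra[unfolded ring_of_type_algebra_def])
  interpret F: cring field_two by (rule F)
  define h where "h a = coeff a {}" for a
  interpret h: ring_hom_ring R field_two h
    by (rule ring_hom_ringI)
      (auto simp: F h_def coeff_add coeff_one coeff_mult clique_empty ring_axioms F.ring_axioms)
  have ker: "a_kernel R field_two h = nilradical R"
    by (auto simp: a_kernel_def' nilradical_eq F h_def)
  have h01: "h \<zero> = 0" "h \<one> = 1" by (simp_all add: h_def coeff_zero coeff_one)
  have both: "h ` A = UNIV" if "\<zero> \<in> A" "\<one> \<in> A" for A
  proof -
    have "x \<in> h ` A" for x using that h01 by (cases x) force+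
    then show ?thesis by blast
  qed
  have "h ` carrier R = carrier field_two" by (simp add: F both)
  then have "(\<lambda>Y. the_elem (h ` Y)) \<in> ring_iso (R Quot nilradical R) field_two"
    using h.FactRing_iso_set unfolding ker by blast
  moreover have "(\<lambda>Y. the_elem (h ` Y)) ` quotient_grading R G (nilradical R) n = field_two_grading n" for n
  proof -
    have "(\<lambda>Y. the_elem (h ` Y)) ` quotient_grading R G (nilradical R) n = h ` G n"
      unfolding quotient_grading_def image_image ker[symmetric]
      by (intro image_cong) (simp_all add: homogeneous_carrier)
    also have "\<dots> = field_two_grading n"
    proof (cases "n = 0")
      case True
      have "\<zero> \<in> G 0" "\<one> \<in> G 0" by (auto simp: grading_iff coeff_zero coeff_one)
      then show ?thesis using both True by (simp add: field_two_grading_def)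
    next
      case False
      have "\<zero> \<in> G n" by (simp add: grading_iff coeff_zero)
      moreover have "h a = 0" if "a \<in> G n" for a
        using that False by (auto simp: grading_iff h_def dest!: spec[of _ "{}"])
      ultimately show ?thesis using False h01 by (force simp: field_two_grading_def)
    qed
    finally show ?thesis .
  qed
  ultimately show ?thesis by (auto simp: graded_ring_iso_def)
qed

lemma fresh_nonadjacent:
  assumes "finite U" "finite T"
  shows "\<exists>v. v \<notin> T \<and> (\<forall>u\<in>U. \<not> adj v u)"
proof -
  obtain N where "\<forall>t\<in>T. t < N" using assms finite_nat_set_iff_bounded by blast
  moreover obtain v where "v > N" "\<forall>u\<in>U. \<not> adj v u" using adj_extension[of "{}" U N] assms(1) by auto
  ultimately show ?thesis by (metis order_less_asym)
qed

definition support_vertices :: "'a \<Rightarrow> nat set" where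
  "support_vertices a = \<Union>{C. coeff a C \<noteq> 0}"

lemma support_vertices_finite: "a \<in> carrier R \<Longrightarrow> finite (support_vertices a)"
  unfolding support_vertices_def using coeff_finite coeff_clique clique_finite by blast

text \<open>
  The augmentation ideal is not finitely generated: if \<open>v\<close> occurs in none of finitely many generators
  without constant term, then the coefficient of \<open>x\<^sub>v\<close> vanishes on the whole ideal that they generate.
\<close>
lemma not_noetherian: "\<not> graded_noetherian R G"
proof
  assume noeth: "graded_noetherian R G"
  define V where "V = range (\<lambda>i. mon {i})"
  have XG: "V \<subseteq> (\<Union>n. G n)" using mon_homogeneous[OF clique_singleton] by (auto simp: V_def)
  then have XR: "V \<subseteq> carrier R" using homogeneous_carrier by blast
  obtain S where S: "finite S" "S \<subseteq> (\<Union>n. G n)" "Idl V = Idl S"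
    using noeth homogeneous_Idl[OF graded XG] by (auto simp: graded_noetherian_def finitely_generated_ideal_def)
  have SR: "S \<subseteq> carrier R" using S homogeneous_carrier by blast
  have "Idl V \<subseteq> {a \<in> carrier R. \<forall>C\<in>{{}}. coeff a C = 0}"
    using XR by (intro genideal_minimal ideal_vanishing) (auto simp: V_def coeff_mon clique_singleton)
  then have S0: "coeff s {} = 0" if "s \<in> S" for s
    using genideal_self[OF SR] S(3) that by auto
  have "finite (\<Union>s\<in>S. support_vertices s)" using S SR support_vertices_finite by auto
  then obtain v where v: "v \<notin> (\<Union>s\<in>S. support_vertices s)" using ex_new_if_finite infinite_UNIV_nat by blast
  then have "Idl S \<subseteq> {a \<in> carrier R. \<forall>C\<in>{{}, {v}}. coeff a C = 0}"
    using SR S0 by (intro genideal_minimal ideal_vanishing) (auto simp: support_vertices_def)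
  moreover have "mon {v} \<in> Idl S" using genideal_self[OF XR] S(3) by (auto simp: V_def)
  ultimately show False by (auto simp: coeff_mon clique_singleton)
qed

text \<open>
  The annihilator of \<open>J\<close> is large enough because of the extension property: for each monomial \<open>x\<^sub>C\<close> outside
  \<open>J\<close> there is a vertex \<open>v\<close> such that \<open>x\<^sub>v\<close> kills all generators of \<open>J\<close> but not \<open>x\<^sub>C\<close>.
\<close>
lemma double_annihilator: "double_annihilator_condition R G"
  unfolding double_annihilator_condition_def
proof (intro allI impI)
  fix J assume "finitely_generated_ideal R G J"
  then obtain S where S: "finite S" "S \<subseteq> (\<Union>n. G n)" and J: "J = Idl S"
    by (auto simp: finitely_generated_ideal_def)
  have SR: "S \<subseteq> carrier R" using S homogeneous_carrier by blast
  interpret ideal J R unfolding J by (rule genideal_ideal[OF SR])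
  show "ann R (ann R J) = J"
  proof
    show "J \<subseteq> ann R (ann R J)" using m_comm Icarr by (auto simp: ann_def)
    show "ann R (ann R J) \<subseteq> J"
    proof
      fix q assume q: "q \<in> ann R (ann R J)"
      then have qR: "q \<in> carrier R" by (simp add: ann_def)
      show "q \<in> J"
      proof (rule mem_ideal_if_monomials[OF is_ideal qR], rule ccontr)
        fix C assume qC: "coeff q C \<noteq> 0" and nJ: "mon C \<notin> J"
        have C: "clique adj C" by (rule coeff_clique[OF qR qC])
        \<comment> \<open>A generator dividing \<open>x\<^sub>C\<close> would put \<open>x\<^sub>C\<close> into \<open>J\<close>, so every nonzero generator has a vertex in \<open>U\<close>.\<close>
        define U where "U = (\<Union>s\<in>S. support_vertices s) - C"
        have "finite U" unfolding U_def using S(1) SR support_vertices_finite by blast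
        \<comment> \<open>The bound \<open>N\<close> keeps \<open>v\<close> out of \<open>C\<close>, so that \<open>x\<^sub>v x\<^sub>C\<close> is the monomial of \<open>C \<union> {v}\<close> and not zero.\<close>
        obtain N where N: "\<forall>t\<in>C. t < N" using clique_finite[OF C] finite_nat_set_iff_bounded by blast
        obtain v where v: "v > N" "\<forall>d\<in>C. adj v d" "\<forall>u\<in>U. \<not> adj v u"
          using adj_extension[OF clique_finite[OF C] \<open>finite U\<close>, of N] by (auto simp: U_def)
        have vC: "v \<notin> C" using N v by auto
        have Cv: "clique adj (insert v C)" using C v(2) adj_sym by (auto simp: clique_def)
        have mv: "mon {v} \<in> carrier R" by (rule mon_closed[OF clique_singleton])
        have "mon {v} \<otimes> s = \<zero>" if s: "s \<in> S" for s
        proof (rule zero_if_coeff_zero, goal_cases)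
          case 1
          then show ?case using mv s SR by auto
        next
          case (2 K)
          have sR: "s \<in> carrier R" using s SR by blast
          show ?case
          proof (rule ccontr)
            assume "coeff (mon {v} \<otimes> s) K \<noteq> 0"
            then have K: "clique adj K" "v \<in> K" "coeff s (K - {v}) \<noteq> 0"
              using sR by (auto simp: coeff_mon_mult clique_singleton split: if_splits)
            then have sm: "s = mon (K - {v})" using S s homogeneous_eq_mon by blast
            have "\<not> K - {v} \<subseteq> C"
            proof
              assume "K - {v} \<subseteq> C"
              then have "s \<otimes> mon (C - (K - {v})) = mon C" using mon_factor[OF C] sm by simp
              moreover have "s \<in> J" unfolding J using genideal_self[OF SR] s by blast
              ultimately show False
                using nJ I_r_closed mon_closed[OF clique_subset[OF C Diff_subset]] by metis
            qed
            then obtain u where u: "u \<in> K - {v}" "u \<notin> C" by blast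
            then have "u \<in> U" using s K by (auto simp: U_def support_vertices_def)
            then show False using v(3) K u by (auto simp: clique_def)
          qed
        qed
        then have "mon {v} \<in> ann R J" unfolding J by (intro ann_genideal mv SR)
        then have "mon {v} \<otimes> q = \<zero>" using q qR mv m_comm by (auto simp: ann_def)
        then have "coeff (mon {v} \<otimes> q) (insert v C) = 0" by (simp add: coeff_zero)
        then show False
          using qC vC Cv by (simp add: coeff_mon_mult[OF clique_singleton qR])
      qed
    qed
  qed
qed

end

section \<open>Finitely presented ideals\<close>

definition unit_vector :: "('a, 'c) ring_scheme \<Rightarrow> int list \<Rightarrow> nat \<Rightarrow> nat \<Rightarrow> 'a" where
  "unit_vector R ds i = (\<lambda>j\<in>{..<length ds}. if j = i then \<one>\<^bsub>R\<^esub> else \<zero>\<^bsub>R\<^esub>)"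

lemma free_module_simps:
  "carrier (free_module R ds) = {..<length ds} \<rightarrow>\<^sub>E carrier R"
  "\<zero>\<^bsub>free_module R ds\<^esub> = (\<lambda>i\<in>{..<length ds}. \<zero>\<^bsub>R\<^esub>)"
  "u \<oplus>\<^bsub>free_module R ds\<^esub> v = (\<lambda>i\<in>{..<length ds}. u i \<oplus>\<^bsub>R\<^esub> v i)"
  "a \<odot>\<^bsub>free_module R ds\<^esub> u = (\<lambda>i\<in>{..<length ds}. a \<otimes>\<^bsub>R\<^esub> u i)"
  by (simp_all add: free_module_def)

lemma ideal_module_simps:
  "carrier (ideal_module R J) = J"
  "\<zero>\<^bsub>ideal_module R J\<^esub> = \<zero>\<^bsub>R\<^esub>"
  "u \<oplus>\<^bsub>ideal_module R J\<^esub> v = u \<oplus>\<^bsub>R\<^esub> v"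
  "a \<odot>\<^bsub>ideal_module R J\<^esub> u = a \<otimes>\<^bsub>R\<^esub> u"
  by (simp_all add: ideal_module_def)

context cring
begin

lemma free_module_zero_closed: "\<zero>\<^bsub>free_module R ds\<^esub> \<in> carrier (free_module R ds)"
  by (auto simp: free_module_simps)

lemma unit_vector_closed: "unit_vector R ds i \<in> carrier (free_module R ds)"
  by (auto simp: free_module_simps unit_vector_def)

lemma free_module_add_closed:
  "u \<in> carrier (free_module R ds) \<Longrightarrow> v \<in> carrier (free_module R ds) \<Longrightarrow>
    u \<oplus>\<^bsub>free_module R ds\<^esub> v \<in> carrier (free_module R ds)"
  by (auto simp: free_module_simps PiE_mem)

lemma free_module_smult_closed:
  "a \<in> carrier R \<Longrightarrow> u \<in> carrier (free_module R ds) \<Longrightarrow>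
    a \<odot>\<^bsub>free_module R ds\<^esub> u \<in> carrier (free_module R ds)"
  by (auto simp: free_module_simps PiE_mem)

text \<open>
  Every vector is the sum of its components along the unit vectors. Stated as an induction rule, this
  replaces matrices: a property of linear maps need only be checked on multiples of unit vectors.
\<close>
lemma free_module_induct [consumes 1, case_names zero add smult]:
  assumes u: "u \<in> carrier (free_module R ds)"
    and zero: "P \<zero>\<^bsub>free_module R ds\<^esub>"
    and add: "\<And>v w. v \<in> carrier (free_module R ds) \<Longrightarrow> w \<in> carrier (free_module R ds) \<Longrightarrow>
      P v \<Longrightarrow> P w \<Longrightarrow> P (v \<oplus>\<^bsub>free_module R ds\<^esub> w)"
    and smult: "\<And>a i. a \<in> carrier R \<Longrightarrow> i < length ds \<Longrightarrow>
      P (a \<odot>\<^bsub>free_module R ds\<^esub> unit_vector R ds i)"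
  shows "P u"
proof -
  let ?n = "length ds"
  have uR: "u i \<in> carrier R" if "i < ?n" for i using u that by (auto simp: free_module_simps)
  define t where "t k = (\<lambda>i\<in>{..<?n}. if i < k then u i else \<zero>)" for k
  have tc: "t k \<in> carrier (free_module R ds)" for k
    using uR by (auto simp: t_def free_module_simps)
  have "P (t k)" if "k \<le> ?n" for k
    using that
  proof (induction k)
    case 0
    have "t 0 = \<zero>\<^bsub>free_module R ds\<^esub>" by (simp add: t_def free_module_simps fun_eq_iff)
    then show ?case using zero by simp
  next
    case (Suc k)
    have "t (Suc k) = t k \<oplus>\<^bsub>free_module R ds\<^esub> (u k \<odot>\<^bsub>free_module R ds\<^esub> unit_vector R ds k)"
      using Suc.prems uR by (auto simp: t_def free_module_simps unit_vector_def fun_eq_iff less_Suc_eq)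
    moreover have "P (t k \<oplus>\<^bsub>free_module R ds\<^esub> (u k \<odot>\<^bsub>free_module R ds\<^esub> unit_vector R ds k))"
      using Suc uR[of k] by (intro add tc smult free_module_smult_closed unit_vector_closed) simp_all
    ultimately show ?case by simp
  qed
  moreover have "t ?n = u"
    by (rule PiE_ext[OF tc[unfolded free_module_simps] u[unfolded free_module_simps]]) (simp add: t_def)
  ultimately show ?thesis by (metis order_refl)
qed

lemma graded_hom_zero:
  assumes "h \<in> graded_hom R (free_module R es) H (free_module R ds) K"
  shows "h \<zero>\<^bsub>free_module R es\<^esub> = \<zero>\<^bsub>free_module R ds\<^esub>"
proof -
  have z: "\<zero>\<^bsub>free_module R es\<^esub> = \<zero> \<odot>\<^bsub>free_module R es\<^esub> \<zero>\<^bsub>free_module R es\<^esub>"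
    by (auto simp: free_module_simps)
  have c: "h \<zero>\<^bsub>free_module R es\<^esub> \<in> carrier (free_module R ds)"
    using assms free_module_zero_closed by (auto simp: graded_hom_def)
  have "h \<zero>\<^bsub>free_module R es\<^esub> = h (\<zero> \<odot>\<^bsub>free_module R es\<^esub> \<zero>\<^bsub>free_module R es\<^esub>)"
    by (rule arg_cong[OF z])
  also have "\<dots> = \<zero> \<odot>\<^bsub>free_module R ds\<^esub> h \<zero>\<^bsub>free_module R es\<^esub>"
    using assms free_module_zero_closed[of es] unfolding graded_hom_def by blast
  also have "\<dots> = \<zero>\<^bsub>free_module R ds\<^esub>"
    unfolding free_module_simps using c
    by (intro restrict_ext l_null) (auto simp: free_module_simps PiE_mem)
  finally show ?thesis .
qed

end

lemma (in clique_algebra) coeff_mult_singleton: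
  assumes "a \<in> carrier R" "b \<in> carrier R"
  shows "coeff (a \<otimes> b) {v} = coeff a {} * coeff b {v} + coeff a {v} * coeff b {}"
  using assms by (simp add: coeff_mult clique_singleton Pow_insert)

text \<open>Any other summand of the product formula involves a coefficient of \<open>b\<close> at a proper subset of \<open>C\<close>.\<close>
lemma (in clique_algebra) coeff_mult_minimal:
  assumes a: "a \<in> carrier R" and b: "b \<in> carrier R"
    and low: "\<And>K. card K < card C \<Longrightarrow> coeff b K = 0"
  shows "coeff (a \<otimes> b) C = coeff a {} * coeff b C"
proof (cases "clique adj C")
  case True
  have fin: "finite C" by (rule clique_finite[OF True])
  have "coeff (a \<otimes> b) C = (\<Sum>D\<in>Pow C. coeff a D * coeff b (C - D))" by (rule coeff_mult[OF a b True])
  also have "\<dots> = (\<Sum>D\<in>{{}}. coeff a D * coeff b (C - D))"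
  proof (rule sum.mono_neutral_right)
    show "\<forall>D\<in>Pow C - {{}}. coeff a D * coeff b (C - D) = 0"
    proof
      fix D assume "D \<in> Pow C - {{}}"
      then have "card (C - D) < card C" using fin by (intro psubset_card_mono) auto
      then show "coeff a D * coeff b (C - D) = 0" using low by simp
    qed
  qed (use fin in auto)
  finally show ?thesis by simp
qed (use assms coeff_nonclique in simp)

text \<open>
  This is the form in which Nakayama's lemma enters. In the lowest size of monomials occurring in the
  images of the unit vectors, a linear map depends only on the constant terms of its argument.
\<close>
lemma (in clique_algebra) coeff_of_lowest_size:
  fixes ds :: "int list"
  assumes h: "h \<in> graded_hom R (free_module R ds) H (ideal_module R J) K" and J: "ideal J R"
    and low: "\<And>i K. i < length ds \<Longrightarrow> card K < card C \<Longrightarrow> coeff (h (unit_vector R ds i)) K = 0"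
    and u: "u \<in> carrier (free_module R ds)"
  shows "coeff (h u) C = (\<Sum>i<length ds. coeff (u i) {} * coeff (h (unit_vector R ds i)) C)"
  using u
proof (induction rule: free_module_induct)
  interpret ideal J R by fact
  have hJ: "h v \<in> carrier R" if "v \<in> carrier (free_module R ds)" for v
    using h that unfolding graded_hom_def ideal_module_simps by (blast intro: Icarr)
  have h_add: "h (v \<oplus>\<^bsub>free_module R ds\<^esub> w) = h v \<oplus> h w"
    if "v \<in> carrier (free_module R ds)" "w \<in> carrier (free_module R ds)" for v w
    using h that by (simp add: graded_hom_def ideal_module_simps)
  have h_smult: "h (a \<odot>\<^bsub>free_module R ds\<^esub> v) = a \<otimes> h v"
    if "a \<in> carrier R" "v \<in> carrier (free_module R ds)" for a v
    using h that by (simp add: graded_hom_def ideal_module_simps)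
  {
    case zero
    have "\<zero>\<^bsub>free_module R ds\<^esub> = \<zero> \<odot>\<^bsub>free_module R ds\<^esub> \<zero>\<^bsub>free_module R ds\<^esub>"
      by (auto simp: free_module_simps)
    then have "h \<zero>\<^bsub>free_module R ds\<^esub> = \<zero>"
      using h_smult[OF subsetD[OF a_subset zero_closed] free_module_zero_closed] hJ[OF free_module_zero_closed[of ds]] by simp
    moreover have "coeff (\<zero>\<^bsub>free_module R ds\<^esub> i) {} = 0" if "i < length ds" for i
      using that by (simp add: free_module_simps coeff_zero)
    ultimately show ?case by (simp add: coeff_zero)
  next
    case (add v w)
    then have "v i \<in> carrier R" "w i \<in> carrier R" if "i < length ds" for i
      using that by (auto simp: free_module_simps)
    then have "coeff ((v \<oplus>\<^bsub>free_module R ds\<^esub> w) i) {} = coeff (v i) {} + coeff (w i) {}"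
      if "i < length ds" for i
      using that by (simp add: free_module_simps coeff_add)
    then show ?case
      using add by (simp add: h_add hJ coeff_add distrib_right sum.distrib)
  next
    case (smult a i)
    let ?e = "unit_vector R ds i"
    have "coeff (h (a \<odot>\<^bsub>free_module R ds\<^esub> ?e)) C = coeff a {} * coeff (h ?e) C"
      using smult low by (simp add: h_smult unit_vector_closed coeff_mult_minimal hJ)
    also have "\<dots> = (\<Sum>j<length ds. if j = i then coeff a {} * coeff (h ?e) C else 0)"
      using smult by simp
    also have "\<dots> = (\<Sum>j<length ds. coeff ((a \<odot>\<^bsub>free_module R ds\<^esub> ?e) j) {} * coeff (h (unit_vector R ds j)) C)"
      using smult by (intro sum.cong) (auto simp: free_module_simps unit_vector_def coeff_zero)
    finally show ?case .
  }
qed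

text \<open>
  Multiplication by \<open>x\<^sub>v\<close> kills a proper finitely generated ideal for infinitely many \<open>v\<close>, and these
  infinitely many relations do not follow from finitely many, unless the generators were redundant.
\<close>
lemma (in clique_algebra) finitely_presented_ideal_trivial:
  assumes J: "ideal J R" and fp: "finitely_presented R G (ideal_module R J) H"
  shows "J = {\<zero>} \<or> J = carrier R"
proof (rule disjCI)
  assume proper: "J \<noteq> carrier R"
  interpret ideal J R by fact
  obtain es ds f g where
    f: "f \<in> graded_hom R (free_module R es) (free_grading G es) (free_module R ds) (free_grading G ds)" and
    g: "g \<in> graded_hom R (free_module R ds) (free_grading G ds) (ideal_module R J) H" and
    exact: "f ` carrier (free_module R es) = {u \<in> carrier (free_module R ds). g u = \<zero>}" and
    surj: "g ` carrier (free_module R ds) = J"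
    using fp by (auto simp: finitely_presented_def ideal_module_simps)
  let ?F = "free_module R es" and ?P = "free_module R ds"
  let ?n = "length ds"
  define y where "y i = g (unit_vector R ds i)" for i
  define z where "z k = f (unit_vector R es k)" for k
  have yJ: "y i \<in> J" for i unfolding y_def using surj unit_vector_closed by blast
  then have yR: "y i \<in> carrier R" for i by (rule Icarr)
  have zP: "z k \<in> carrier ?P" and gz: "g (z k) = \<zero>" for k
    using exact unit_vector_closed[of es k] by (auto simp: z_def)
  have zR: "z k j \<in> carrier R" if "j < ?n" for k j
    using zP[of k] that by (auto simp: free_module_simps)
  have y0: "coeff (y i) {} = 0" for i using ideal_whole_if_constant_coeff[OF J yJ] proper by blast
  define U where "U = (\<Union>i<?n. support_vertices (y i))"
  define T where "T = (\<Union>k<length es. \<Union>j<?n. support_vertices (z k j))"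
  have "finite U" "finite T" unfolding U_def T_def using yR zR support_vertices_finite by auto
  then obtain v where v: "v \<notin> T" "\<forall>u\<in>U. \<not> adj v u" using fresh_nonadjacent by blast
  have mv: "mon {v} \<in> carrier R" by (rule mon_closed[OF clique_singleton])
  \<comment> \<open>Each monomial of \<open>y i\<close> has a vertex, by the absence of constant terms, and that vertex is not
    adjacent to \<open>v\<close>. So \<open>x\<^sub>v\<close> kills \<open>y i\<close>, which makes \<open>x\<^sub>v e\<^sub>i\<close> a relation.\<close>
  have kills: "mon {v} \<otimes> y i = \<zero>" if i: "i < ?n" for i
  proof (rule zero_if_coeff_zero, rule m_closed[OF mv yR], rule ccontr)
    fix K assume "coeff (mon {v} \<otimes> y i) K \<noteq> 0"
    then have K: "clique adj K" "v \<in> K" "coeff (y i) (K - {v}) \<noteq> 0"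
      using yR by (auto simp: coeff_mon_mult clique_singleton split: if_splits)
    then have "K - {v} \<noteq> {}" using y0 by metis
    then obtain u where u: "u \<in> K - {v}" by blast
    then have "u \<in> U" using K i by (auto simp: U_def support_vertices_def)
    then show False using v(2) K u by (auto simp: clique_def)
  qed
  have "f \<zero>\<^bsub>?F\<^esub> \<in> f ` carrier ?F" by (intro imageI free_module_zero_closed)
  then have g_zero: "g \<zero>\<^bsub>?P\<^esub> = \<zero>" unfolding exact graded_hom_zero[OF f] by blast
  \<comment> \<open>As \<open>v\<close> does not occur in the relations \<open>z k\<close>, it can only come from their coefficients. So the
    coefficients of \<open>x\<^sub>v\<close> in a combination of the \<open>z k\<close> are the constant terms of another relation \<open>w\<close>.\<close>
  have transfer: "\<exists>w\<in>carrier ?P. g w = \<zero> \<and> (\<forall>j<?n. coeff (f b j) {v} = coeff (w j) {})"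
    if "b \<in> carrier ?F" for b
    using that
  proof (induction rule: free_module_induct)
    case zero
    show ?case
    proof (intro bexI[of _ "\<zero>\<^bsub>?P\<^esub>"] conjI g_zero free_module_zero_closed)
      show "\<forall>j<?n. coeff (f \<zero>\<^bsub>?F\<^esub> j) {v} = coeff (\<zero>\<^bsub>?P\<^esub> j) {}"
        unfolding graded_hom_zero[OF f] by (simp add: free_module_simps coeff_zero)
    qed
  next
    case (add b c)
    then obtain w x where w: "w \<in> carrier ?P" "g w = \<zero>" "\<forall>j<?n. coeff (f b j) {v} = coeff (w j) {}"
      and x: "x \<in> carrier ?P" "g x = \<zero>" "\<forall>j<?n. coeff (f c j) {v} = coeff (x j) {}" by blast
    have fbc: "f b \<in> carrier ?P" "f c \<in> carrier ?P" using add f by (auto simp: graded_hom_def)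
    have "f (b \<oplus>\<^bsub>?F\<^esub> c) = f b \<oplus>\<^bsub>?P\<^esub> f c" using add f by (simp add: graded_hom_def)
    moreover have "g (w \<oplus>\<^bsub>?P\<^esub> x) = \<zero>" using g w x by (simp add: graded_hom_def ideal_module_simps)
    moreover have "coeff ((f b \<oplus>\<^bsub>?P\<^esub> f c) j) {v} = coeff ((w \<oplus>\<^bsub>?P\<^esub> x) j) {}" if "j < ?n" for j
    proof -
      have "f b j \<in> carrier R" "f c j \<in> carrier R" "w j \<in> carrier R" "x j \<in> carrier R"
        using fbc w(1) x(1) that by (auto simp: free_module_simps)
      then show ?thesis using w(3) x(3) that by (simp add: free_module_simps coeff_add)
    qed
    ultimately show ?case
      by (intro bexI[of _ "w \<oplus>\<^bsub>?P\<^esub> x"] free_module_add_closed[OF w(1) x(1)]) simp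
  next
    case (smult a k)
    have "f (a \<odot>\<^bsub>?F\<^esub> unit_vector R es k) = a \<odot>\<^bsub>?P\<^esub> z k"
      using smult f unit_vector_closed[of es k] by (simp add: graded_hom_def z_def)
    moreover have "coeff (z k j) {v} = 0" if "j < ?n" for j
      using v(1) smult that by (auto simp: T_def support_vertices_def)
    ultimately have eq: "coeff (f (a \<odot>\<^bsub>?F\<^esub> unit_vector R es k) j) {v} = coeff a {v} * coeff (z k j) {}"
      if "j < ?n" for j
      using that smult zR by (simp add: free_module_simps coeff_mult_singleton)
    show ?case
    proof (cases "coeff a {v} = 0")
      case True
      have "coeff (\<zero>\<^bsub>?P\<^esub> j) {} = 0" if "j < ?n" for j
        using that by (simp add: free_module_simps coeff_zero)
      then show ?thesis
        using eq True by (intro bexI[of _ "\<zero>\<^bsub>?P\<^esub>"] conjI g_zero free_module_zero_closed) simp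
    next
      case False
      then show ?thesis using eq bit_one_if[OF False] zP gz by (intro bexI[of _ "z k"]) auto
    qed
  qed
  \<comment> \<open>Applied to the relation \<open>x\<^sub>v e\<^sub>i\<close>, this gives a relation with constant term \<open>e\<^sub>i\<close>, which expresses \<open>y i\<close>
    as a combination of the \<open>y j\<close> with coefficients in the augmentation ideal.\<close>
  have unit_in_kernel: "\<exists>w\<in>carrier ?P. g w = \<zero> \<and> (\<forall>j<?n. coeff (w j) {} = of_bool (j = i))" if i: "i < ?n" for i
  proof -
    let ?x = "mon {v} \<odot>\<^bsub>?P\<^esub> unit_vector R ds i"
    have "?x \<in> carrier ?P" by (rule free_module_smult_closed[OF mv unit_vector_closed])
    moreover have "g ?x = \<zero>"
      using g mv unit_vector_closed[of ds i] kills[OF i] by (simp add: graded_hom_def ideal_module_simps y_def)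
    ultimately have "?x \<in> f ` carrier ?F" unfolding exact by (intro CollectI conjI)
    then obtain b where b: "b \<in> carrier ?F" "f b = ?x" by (metis imageE)
    have "coeff (?x j) {v} = of_bool (j = i)" if "j < ?n" for j
      using that mv by (simp add: free_module_simps unit_vector_def coeff_mon clique_singleton coeff_zero)
    then show ?thesis using transfer[OF b(1)] unfolding b(2) by (metis (no_types, lifting))
  qed
  \<comment> \<open>By induction on the size of \<open>C\<close>: if all smaller monomials are absent from all \<open>y j\<close>, applying \<open>g\<close>
    to the relation with constant term \<open>e\<^sub>i\<close> leaves just the coefficient of \<open>y i\<close> at \<open>C\<close>.\<close>
  have y_zero: "coeff (y i) C = 0" if "i < ?n" for i C
    using that
  proof (induction "card C" arbitrary: i C rule: less_induct)
    case less
    have low: "\<And>i K. i < ?n \<Longrightarrow> card K < card C \<Longrightarrow> coeff (g (unit_vector R ds i)) K = 0"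
      using less.hyps unfolding y_def by blast
    obtain w where w: "w \<in> carrier ?P" "g w = \<zero>" "\<forall>j<?n. coeff (w j) {} = of_bool (j = i)"
      using unit_in_kernel[OF less.prems] by blast
    have "0 = coeff (g w) C" by (simp add: w coeff_zero)
    also have "\<dots> = (\<Sum>j<?n. coeff (w j) {} * coeff (y j) C)"
      unfolding y_def by (rule coeff_of_lowest_size[OF g J low w(1)])
    also have "\<dots> = (\<Sum>j<?n. if j = i then coeff (y i) C else 0)"
      using w(3) by (intro sum.cong) auto
    also have "\<dots> = coeff (y i) C" using less.prems by simp
    finally show ?case by simp
  qed
  have "g u = \<zero>" if u: "u \<in> carrier ?P" for u
  proof (rule zero_if_coeff_zero)
    show "g u \<in> carrier R" using surj u Icarr by blast
    show "coeff (g u) C = 0" for C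
      using coeff_of_lowest_size[OF g J _ u, of C] y_zero by (simp add: y_def)
  qed
  then show "J = {\<zero>}" using surj free_module_zero_closed[of ds] by force
qed

lemma (in cring) finitely_presented_zero_ideal:
  "finitely_presented R G (ideal_module R {\<zero>}) (\<lambda>n. {\<zero>} \<inter> G n)"
  if g: "\<And>n. additive_subgroup (G n) R"
proof -
  have [simp]: "\<zero> \<in> G n" for n using additive_subgroup.zero_closed[OF g] .
  show ?thesis
    unfolding finitely_presented_def
    by (intro exI[of _ "[]"] exI[of _ "\<lambda>_ _. undefined"] exI[of _ "\<lambda>_. \<zero>"])
      (auto simp: graded_hom_def free_module_simps ideal_module_simps free_grading_def)
qed

lemma (in cring) finitely_presented_whole_ring:
  "finitely_presented R G (ideal_module R (carrier R)) (\<lambda>n. carrier R \<inter> G n)"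
  if g: "\<And>n. additive_subgroup (G n) R"
proof -
  have z: "\<zero> \<in> G n" and sub: "G n \<subseteq> carrier R" for n
    using additive_subgroup.zero_closed[OF g] additive_subgroup.a_subset[OF g] by auto
  let ?z = "\<lambda>i\<in>{..<Suc 0}. \<zero>"
  have "(\<lambda>u. u 0) ` ({..<Suc 0} \<rightarrow>\<^sub>E carrier R) = carrier R"
  proof -
    have "a \<in> (\<lambda>u. u 0) ` ({..<Suc 0} \<rightarrow>\<^sub>E carrier R)" if "a \<in> carrier R" for a
      using that by (intro image_eqI[of _ _ "\<lambda>i\<in>{..<Suc 0}. a"]) auto
    then show ?thesis by auto
  qed
  moreover have "{u \<in> {..<Suc 0} \<rightarrow>\<^sub>E carrier R. u 0 = \<zero>} = {?z}"
  proof -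
    have "u = ?z" if "u \<in> {..<Suc 0} \<rightarrow>\<^sub>E carrier R" "u 0 = \<zero>" for u
      by (rule PiE_ext[OF that(1)]) (use that(2) in auto)
    moreover have "?z \<in> {..<Suc 0} \<rightarrow>\<^sub>E carrier R" "?z 0 = \<zero>" by auto
    ultimately show ?thesis by blast
  qed
  moreover have "(\<lambda>_. ?z) \<in> graded_hom R (free_module R []) (free_grading G [])
      (free_module R [0]) (free_grading G [0])"
    using z by (auto simp: graded_hom_def free_module_simps free_grading_def)
  moreover have "(\<lambda>u. u 0) \<in> graded_hom R (free_module R [0]) (free_grading G [0])
      (ideal_module R (carrier R)) (\<lambda>n. carrier R \<inter> G n)"
  proof -
    have "u 0 \<in> G n" if "u \<in> free_grading G [0] n" for u n
      using PiE_mem[of u "{..<length [0]}" "\<lambda>i. G (n - [0] ! i)" 0] that by (simp add: free_grading_def)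
    then show ?thesis
      using sub by (auto simp: graded_hom_def free_module_simps ideal_module_simps PiE_mem)
  qed
  ultimately show ?thesis
    unfolding finitely_presented_def
    by (intro exI[of _ "[]"] exI[of _ "[0]"] exI[of _ "\<lambda>_. ?z"] exI[of _ "\<lambda>u. u 0"])
      (simp add: free_module_simps ideal_module_simps image_constant_conv)
qed

lemma (in clique_algebra) totally_incoherent: "totally_incoherent R G"
proof -
  have g: "additive_subgroup (G n) R" for n using graded by (simp add: graded_ring_def graded_by_def)
  have "J \<in> {J. homogeneous_ideal R G J \<and> finitely_presented R G (ideal_module R J) (\<lambda>n. J \<inter> G n)}"
    if "J \<in> {{\<zero>}, carrier R}" for J
    using that homogeneous_zero_ideal homogeneous_whole_ring
      finitely_presented_zero_ideal[of G, OF g] finitely_presented_whole_ring[of G, OF g] by blast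
  moreover have "J \<in> {{\<zero>}, carrier R}"
    if "homogeneous_ideal R G J" "finitely_presented R G (ideal_module R J) (\<lambda>n. J \<inter> G n)" for J
    using that finitely_presented_ideal_trivial[of J] unfolding homogeneous_ideal_def by blast
  ultimately show ?thesis unfolding totally_incoherent_def by blast
qed

section \<open>Failure of self-injectivity\<close>

text \<open>
  The ideal \<open>J\<close> as a graded module, transported along an injection \<open>\<iota>\<close> of the ring into another type, so
  that it can serve as a test module in a prescribed universe.
\<close>
definition copy_module :: "('a, 'c) ring_scheme \<Rightarrow> 'a set \<Rightarrow> ('a \<Rightarrow> 'm) \<Rightarrow> ('a, 'm) module" where
  "copy_module R J \<iota> = (let \<kappa> = the_inv_into (carrier R) \<iota> in
     \<lparr>carrier = \<iota> ` J, monoid.mult = (\<lambda>x y. \<iota> (\<kappa> x \<otimes>\<^bsub>R\<^esub> \<kappa> y)), one = \<iota> \<one>\<^bsub>R\<^esub>,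
      ring.zero = \<iota> \<zero>\<^bsub>R\<^esub>, ring.add = (\<lambda>x y. \<iota> (\<kappa> x \<oplus>\<^bsub>R\<^esub> \<kappa> y)),
      module.smult = (\<lambda>a x. \<iota> (a \<otimes>\<^bsub>R\<^esub> \<kappa> x))\<rparr>)"

lemma copy_module_simps:
  assumes "inj_on \<iota> (carrier R)"
  shows "carrier (copy_module R J \<iota>) = \<iota> ` J"
    "\<zero>\<^bsub>copy_module R J \<iota>\<^esub> = \<iota> \<zero>\<^bsub>R\<^esub>"
    "a \<in> carrier R \<Longrightarrow> b \<in> carrier R \<Longrightarrow> \<iota> a \<oplus>\<^bsub>copy_module R J \<iota>\<^esub> \<iota> b = \<iota> (a \<oplus>\<^bsub>R\<^esub> b)"
    "b \<in> carrier R \<Longrightarrow> a \<odot>\<^bsub>copy_module R J \<iota>\<^esub> \<iota> b = \<iota> (a \<otimes>\<^bsub>R\<^esub> b)"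
  using assms by (simp_all add: copy_module_def Let_def the_inv_into_f_f)

lemma graded_module_copy:
  assumes gr: "graded_ring R G" and J: "homogeneous_ideal R G J" and inj: "inj_on \<iota> (carrier R)"
  shows "graded_module R G (copy_module R J \<iota>) (\<lambda>n. \<iota> ` (J \<inter> G n))"
proof -
  let ?M = "copy_module R J \<iota>"
  interpret R: cring R using gr by (simp add: graded_ring_def)
  interpret J: ideal J R using J by (simp add: homogeneous_ideal_def)
  note M = copy_module_simps[OF inj, where J = J]
  have JR: "a \<in> carrier R" if "a \<in> J" for a by (rule J.Icarr[OF that])
  have inj_eq: "\<iota> a = \<iota> b \<longleftrightarrow> a = b" if "a \<in> J" "b \<in> J" for a b
    using inj JR that by (auto dest: inj_onD)
  have smult_J: "a \<otimes>\<^bsub>R\<^esub> b \<in> J" if "a \<in> carrier R" "b \<in> J" for a b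
    using J.I_l_closed that by blast
  have "abelian_group ?M"
  proof (rule abelian_groupI)
    show "\<exists>y\<in>carrier ?M. y \<oplus>\<^bsub>?M\<^esub> x = \<zero>\<^bsub>?M\<^esub>" if x: "x \<in> carrier ?M" for x
    proof -
      obtain a where a: "a \<in> J" "x = \<iota> a" using x M(1) by auto
      have "\<iota> (\<ominus>\<^bsub>R\<^esub> a) \<oplus>\<^bsub>?M\<^esub> x = \<zero>\<^bsub>?M\<^esub>" using a JR by (simp add: M R.l_neg)
      then show ?thesis using a by (auto simp: M(1))
    qed
  qed (auto simp: M JR R.a_assoc intro!: arg_cong[where f = \<iota>] R.a_comm)
  then interpret M: abelian_group ?M .
  have "module R ?M"
  proof (rule moduleI)
    show "cring R" by (rule R.is_cring)
    show "abelian_group ?M" by fact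
  qed (auto simp: M JR smult_J R.l_distr R.r_distr R.m_assoc)
  moreover have add_sub: "additive_subgroup (\<iota> ` (J \<inter> G n)) ?M" for n
  proof -
    interpret Gn: additive_subgroup "G n" R using gr by (simp add: graded_ring_def graded_by_def)
    have inv: "\<ominus>\<^bsub>?M\<^esub> \<iota> a = \<iota> (\<ominus>\<^bsub>R\<^esub> a)" if "a \<in> J" for a
      using that JR by (intro M.minus_equality) (auto simp: M R.l_neg)
    show ?thesis
      unfolding additive_subgroup_def
    proof (rule M.add.subgroupI)
      show "\<iota> ` (J \<inter> G n) \<noteq> {}" using J.zero_closed Gn.zero_closed by blast
    qed (auto simp: M inv JR)
  qed
  moreover have "graded_by ?M (\<lambda>n. \<iota> ` (J \<inter> G n))"
    unfolding graded_by_def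
  proof (intro conjI allI add_sub ballI)
    fix x assume "x \<in> carrier ?M"
    then obtain a where a: "a \<in> J" "x = \<iota> a" by (auto simp: M)
    \<comment> \<open>Composition with \<open>\<iota>\<close> carries the decompositions of \<open>a\<close> with components in \<open>J\<close> to those of \<open>x\<close>.\<close>
    have transport: "(\<forall>n. (\<iota> \<circ> c) n \<in> \<iota> ` (J \<inter> G n)) \<and> finite {n. (\<iota> \<circ> c) n \<noteq> \<zero>\<^bsub>?M\<^esub>} \<and>
        x = finsum ?M (\<iota> \<circ> c) {n. (\<iota> \<circ> c) n \<noteq> \<zero>\<^bsub>?M\<^esub>} \<longleftrightarrow>
        (\<forall>n. c n \<in> G n) \<and> finite {n. c n \<noteq> \<zero>\<^bsub>R\<^esub>} \<and> a = finsum R c {n. c n \<noteq> \<zero>\<^bsub>R\<^esub>}"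
      if c: "\<And>n. c n \<in> J" for c
    proof -
      have supp: "{n. (\<iota> \<circ> c) n \<noteq> \<zero>\<^bsub>?M\<^esub>} = {n. c n \<noteq> \<zero>\<^bsub>R\<^esub>}"
        using inj_eq[OF c J.zero_closed] by (simp add: M)
      have sum: "finsum R c A \<in> J \<and> finsum ?M (\<iota> \<circ> c) A = \<iota> (finsum R c A)" if "finite A" for A
        using that
      proof (induction A)
        case empty
        then show ?case by (simp add: M)
      next
        case (insert n A)
        have "c \<in> A \<rightarrow> carrier R" "c n \<in> carrier R" "\<iota> \<circ> c \<in> A \<rightarrow> carrier ?M" "(\<iota> \<circ> c) n \<in> carrier ?M"
          using c JR by (auto simp: M)
        then show ?case
          using insert c JR by (simp add: R.finsum_insert M.finsum_insert M J.a_closed)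
      qed
      have "x = finsum ?M (\<iota> \<circ> c) A \<longleftrightarrow> a = finsum R c A" if "finite A" for A
        using sum[OF that] inj_eq[OF a(1), of "finsum R c A"] by (simp add: a(2))
      moreover have "(\<iota> \<circ> c) n \<in> \<iota> ` (J \<inter> G n) \<longleftrightarrow> c n \<in> G n" for n
        using inj_eq c by (auto simp: image_iff)
      ultimately show ?thesis unfolding supp by blast
    qed
    have dec: "\<exists>!c. (\<forall>n. c n \<in> G n) \<and> finite {n. c n \<noteq> \<zero>\<^bsub>R\<^esub>} \<and> a = finsum R c {n. c n \<noteq> \<zero>\<^bsub>R\<^esub>}"
      using gr JR[OF a(1)] by (simp add: graded_ring_def graded_by_def)
    obtain c where c: "\<forall>n. c n \<in> J \<inter> G n" "finite {n. c n \<noteq> \<zero>\<^bsub>R\<^esub>}" "a = finsum R c {n. c n \<noteq> \<zero>\<^bsub>R\<^esub>}"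
      using J a(1) unfolding homogeneous_ideal_def by blast
    show "\<exists>!d. (\<forall>n. d n \<in> \<iota> ` (J \<inter> G n)) \<and> finite {n. d n \<noteq> \<zero>\<^bsub>?M\<^esub>} \<and>
        x = finsum ?M d {n. d n \<noteq> \<zero>\<^bsub>?M\<^esub>}"
    proof (rule ex1I[of _ "\<iota> \<circ> c"])
      show "(\<forall>n. (\<iota> \<circ> c) n \<in> \<iota> ` (J \<inter> G n)) \<and> finite {n. (\<iota> \<circ> c) n \<noteq> \<zero>\<^bsub>?M\<^esub>} \<and>
        x = finsum ?M (\<iota> \<circ> c) {n. (\<iota> \<circ> c) n \<noteq> \<zero>\<^bsub>?M\<^esub>}"
        using c by (subst transport) auto
    next
      fix d assume d: "(\<forall>n. d n \<in> \<iota> ` (J \<inter> G n)) \<and> finite {n. d n \<noteq> \<zero>\<^bsub>?M\<^esub>} \<and>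
        x = finsum ?M d {n. d n \<noteq> \<zero>\<^bsub>?M\<^esub>}"
      then have "\<forall>n. \<exists>b\<in>J. d n = \<iota> b" by blast
      then obtain e where e: "\<And>n. e n \<in> J" "\<And>n. d n = \<iota> (e n)" by metis
      then have de: "d = \<iota> \<circ> e" by auto
      have "e = c" using d[unfolded de transport[OF e(1)]] c dec by blast
      then show "d = \<iota> \<circ> c" using de by simp
    qed
  qed
  moreover have "a \<odot>\<^bsub>?M\<^esub> x \<in> \<iota> ` (J \<inter> G (m + n))" if "a \<in> G m" "x \<in> \<iota> ` (J \<inter> G n)" for a x m n
  proof -
    obtain b where b: "b \<in> J" "b \<in> G n" "x = \<iota> b" using \<open>x \<in> \<iota> ` (J \<inter> G n)\<close> by blast
    have "a \<in> carrier R"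
      using \<open>a \<in> G m\<close> gr additive_subgroup.a_subset unfolding graded_ring_def graded_by_def by blast
    moreover have "a \<otimes>\<^bsub>R\<^esub> b \<in> G (m + n)" using gr \<open>a \<in> G m\<close> b by (simp add: graded_ring_def)
    ultimately show ?thesis using b JR smult_J by (auto simp: M)
  qed
  ultimately show ?thesis using gr unfolding graded_module_def by blast
qed

text \<open>The algebra is countable, as an element amounts to a finite set of finite sets of numbers.\<close>
lemma (in clique_algebra) ex_injection:
  "\<exists>\<iota> :: 'a \<Rightarrow> 'm::infinite. inj_on \<iota> (carrier R)"
proof -
  define code where "code a = set_encode (set_encode ` {C. coeff a C \<noteq> 0})" for a
  have "inj_on code (carrier R)"
  proof (rule inj_onI)
    fix a b assume ab: "a \<in> carrier R" "b \<in> carrier R" "code a = code b"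
    have "finite C" if "coeff a C \<noteq> 0 \<or> coeff b C \<noteq> 0" for C
      using that ab coeff_clique clique_finite by blast
    moreover have "set_encode ` {C. coeff a C \<noteq> 0} = set_encode ` {C. coeff b C \<noteq> 0}"
      using ab(3) coeff_finite[OF ab(1)] coeff_finite[OF ab(2)] by (simp add: code_def set_encode_eq)
    ultimately have "{C. coeff a C \<noteq> 0} = {C. coeff b C \<noteq> 0}"
      by (subst (asm) inj_on_image_eq_iff[OF inj_on_set_encode]) auto
    then have "coeff a C = coeff b C" for C
    proof -
      have "coeff a C \<noteq> 0 \<longleftrightarrow> coeff b C \<noteq> 0" using \<open>{C. coeff a C \<noteq> 0} = _\<close> by blast
      then show ?thesis using bit_one_if[of "coeff a C"] bit_one_if[of "coeff b C"] by metis
    qed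
    then show "a = b" using ab by (intro coeff_eqI) auto
  qed
  moreover obtain e :: "nat \<Rightarrow> 'm" where "inj e"
    using infinite_countable_subset[OF infinite_UNIV] by blast
  ultimately have "inj_on (e \<circ> code) (carrier R)" by (intro comp_inj_on) (auto intro: inj_on_subset)
  then show ?thesis by blast
qed

text \<open>
  For a vertex \<open>v\<close> not adjacent to \<open>0\<close>, no clique contains both \<open>0\<close> and \<open>v\<close>. So discarding the monomials
  without the vertex \<open>0\<close> is linear on \<open>J = (x\<^sub>0, x\<^sub>v)\<close>. It fixes \<open>x\<^sub>0\<close> and kills \<open>x\<^sub>v\<close>. An extension to the
  whole algebra would be multiplication by some \<open>c\<close>, whose constant term would have to be both \<open>1\<close> and \<open>0\<close>.
\<close>
lemma (in clique_algebra) not_self_injective: "\<not> self_injective TYPE('m::infinite) R G"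
proof
  assume inj: "self_injective TYPE('m) R G"
  obtain v where v: "v > 0" "\<not> adj v 0" using adj_extension[of "{}" "{0}" 0] by auto
  define X0 where "X0 = mon {0}"
  define Xv where "Xv = mon {v}"
  have gens: "{X0, Xv} \<subseteq> (\<Union>n. G n)"
    using mon_homogeneous[OF clique_singleton] by (auto simp: X0_def Xv_def)
  have XR: "X0 \<in> carrier R" "Xv \<in> carrier R" by (simp_all add: X0_def Xv_def mon_closed clique_singleton)
  define J where "J = Idl {X0, Xv}"
  have J: "homogeneous_ideal R G J" unfolding J_def by (rule homogeneous_Idl[OF graded gens])
  interpret J: ideal J R using J by (simp add: homogeneous_ideal_def)
  have XJ: "X0 \<in> J" "Xv \<in> J" unfolding J_def using genideal_self[of "{X0, Xv}"] XR by auto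
  have "J \<subseteq> {a \<in> carrier R. \<forall>C\<in>{C. 0 \<notin> C \<and> v \<notin> C}. coeff a C = 0}"
    unfolding J_def using XR
    by (intro genideal_minimal ideal_vanishing) (auto simp: X0_def Xv_def coeff_mon clique_singleton)
  then have J_supp: "0 \<in> C \<or> v \<in> C" if "q \<in> J" "coeff q C \<noteq> 0" for q C using that by blast
  have "\<exists>r\<in>carrier R. coeff r = (\<lambda>C. if 0 \<in> C then coeff q C else 0)" if q: "q \<in> carrier R" for q
  proof (rule coeff_realize)
    show "finite {C. (if 0 \<in> C then coeff q C else 0) \<noteq> 0}"
      by (rule finite_subset[OF _ coeff_finite[OF q]]) auto
    show "\<And>C. (if 0 \<in> C then coeff q C else 0) \<noteq> 0 \<Longrightarrow> clique adj C"
      using coeff_clique[OF q] by (auto split: if_splits)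
  qed
  then obtain part where part_closed: "\<And>q. q \<in> carrier R \<Longrightarrow> part q \<in> carrier R"
    and coeff_part: "\<And>q C. q \<in> carrier R \<Longrightarrow> coeff (part q) C = (if 0 \<in> C then coeff q C else 0)"
    by metis
  have part_add: "part (a \<oplus> b) = part a \<oplus> part b" if "a \<in> carrier R" "b \<in> carrier R" for a b
    using that by (intro coeff_eqI ext) (auto simp: part_closed coeff_part coeff_add)
  have part_smult: "part (a \<otimes> b) = a \<otimes> part b" if a: "a \<in> carrier R" and b: "b \<in> J" for a b
  proof (intro coeff_eqI ext)
    have bR: "b \<in> carrier R" by (rule J.Icarr[OF b])
    show "part (a \<otimes> b) \<in> carrier R" "a \<otimes> part b \<in> carrier R" using a bR part_closed by auto
    fix C
    show "coeff (part (a \<otimes> b)) C = coeff (a \<otimes> part b) C"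
    proof (cases "clique adj C")
      case C: True
      \<comment> \<open>The only way to lose the vertex \<open>0\<close> of \<open>C\<close> is to have it in the factor from \<open>a\<close>. Then the
        factor from \<open>b\<close> contains \<open>v\<close>, which the clique \<open>C\<close> excludes.\<close>
      have eq: "coeff (part b) (C - D) = (if 0 \<in> C then coeff b (C - D) else 0)" for D
      proof (cases "0 \<in> C \<and> 0 \<in> D \<and> coeff b (C - D) \<noteq> 0")
        case True
        then have "v \<in> C" using J_supp[OF b, of "C - D"] by blast
        then have "adj v 0" using C True v(1) by (auto simp: clique_def)
        then show ?thesis using v(2) by blast
      qed (auto simp: coeff_part[OF bR])
      show ?thesis
        using a bR part_closed[OF bR] C by (simp add: coeff_part coeff_mult eq)
    next
      case False
      then show ?thesis using coeff_nonclique a bR part_closed by simp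
    qed
  qed
  have part_grading: "part q \<in> G n" if "q \<in> G n" for q n
    using that part_closed coeff_part by (auto simp: grading_iff split: if_splits)
  obtain \<iota> :: "'a \<Rightarrow> 'm" where \<iota>: "inj_on \<iota> (carrier R)" using ex_injection by blast
  let ?N = "copy_module R (carrier R) \<iota>" and ?L = "\<lambda>n. \<iota> ` (carrier R \<inter> G n)"
  let ?M = "copy_module R J \<iota>" and ?H = "\<lambda>n. \<iota> ` (J \<inter> G n)"
  note simps = copy_module_simps[OF \<iota>] ideal_module_simps
  define \<kappa> where "\<kappa> = the_inv_into (carrier R) \<iota>"
  have \<kappa>: "\<kappa> (\<iota> a) = a" if "a \<in> carrier R" for a
    unfolding \<kappa>_def by (rule the_inv_into_f_f[OF \<iota> that])
  have incl: "(\<lambda>x. x) \<in> graded_hom R ?M ?H ?N ?L"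
    using J.Icarr by (auto simp: graded_hom_def simps)
  have proj: "part \<circ> \<kappa> \<in> graded_hom R ?M ?H (ideal_module R (carrier R)) G"
    using J.Icarr by (auto simp: graded_hom_def simps \<kappa> part_closed part_add part_smult part_grading)
  obtain g where g: "g \<in> graded_hom R ?N ?L (ideal_module R (carrier R)) G"
    and ext: "\<forall>x\<in>carrier ?M. g x = (part \<circ> \<kappa>) x"
    using inj[unfolded self_injective_def graded_injective_def, rule_format, of ?M ?H ?N ?L "\<lambda>x. x" "part \<circ> \<kappa>"]
      graded_module_copy[OF graded J \<iota>] graded_module_copy[OF graded homogeneous_whole_ring \<iota>] incl proj
    by auto
  define c where "c = g (\<iota> \<one>)"
  have cR: "c \<in> carrier R" using g by (auto simp: c_def graded_hom_def simps)
  have mult_c: "part q = q \<otimes> c" if "q \<in> J" for q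
  proof -
    have q: "q \<in> carrier R" by (rule J.Icarr[OF that])
    have "\<forall>x\<in>carrier ?N. g (q \<odot>\<^bsub>?N\<^esub> x) = q \<otimes> g x"
      using g q by (simp add: graded_hom_def ideal_module_simps)
    moreover have "\<iota> \<one> \<in> carrier ?N" by (simp add: simps)
    ultimately have "g (q \<odot>\<^bsub>?N\<^esub> \<iota> \<one>) = q \<otimes> c" by (simp add: c_def)
    then have "g (\<iota> q) = q \<otimes> c" using q by (simp add: simps)
    then show ?thesis using ext that q by (simp add: simps \<kappa>)
  qed
  have "coeff (X0 \<otimes> c) {0} = coeff c {}" "coeff (Xv \<otimes> c) {v} = coeff c {}"
    using cR by (simp_all add: X0_def Xv_def coeff_mon_mult clique_singleton)
  moreover have "coeff (part X0) {0} = 1" "coeff (part Xv) {v} = 0"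
    using XR v(1) by (simp_all add: coeff_part) (simp_all add: X0_def coeff_mon clique_singleton)
  ultimately show False using mult_c[OF XJ(1)] mult_c[OF XJ(2)] by simp
qed

section \<open>The theorem\<close>

lemma rado_clique_algebra: "clique_algebra Q Q_grading rado_edge rado_coeff"
proof -
  interpret cring Q by (rule cring_Q)
  show ?thesis
  proof unfold_locales
    fix x y :: "rado_poly set set" and C D U :: "nat set" and N i j :: nat and n :: int
    show "rado_edge i j = rado_edge j i" by (rule rado_edge_sym)
    show "finite D \<Longrightarrow> finite U \<Longrightarrow> D \<inter> U = {} \<Longrightarrow>
        \<exists>v>N. (\<forall>d\<in>D. rado_edge v d) \<and> (\<forall>u\<in>U. \<not> rado_edge v u)" by (rule rado_extension)
    show "x \<in> carrier Q \<Longrightarrow> y \<in> carrier Q \<Longrightarrow> rado_coeff x = rado_coeff y \<Longrightarrow> x = y"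
      by (rule rado_coeff_eqI)
    show "x \<in> carrier Q \<Longrightarrow> finite {C. rado_coeff x C \<noteq> 0}" by (rule rado_coeff_finite)
    show "rado_coeff x C \<noteq> 0 \<Longrightarrow> clique rado_edge C" by (simp add: rado_coeff_def split: if_splits)
    show "\<exists>a\<in>carrier Q. rado_coeff a = \<phi>"
      if "finite {C. \<phi> C \<noteq> 0}" "\<And>C. \<phi> C \<noteq> 0 \<Longrightarrow> clique rado_edge C" for \<phi>
      using rado_coeff_realize(1)[OF that] rado_proj_closed by blast
    show "rado_coeff (x \<oplus>\<^bsub>Q\<^esub> y) C = rado_coeff x C + rado_coeff y C"
      if "x \<in> carrier Q" "y \<in> carrier Q" using that by (rule rado_coeff_add)
    show "rado_coeff \<one>\<^bsub>Q\<^esub> C = of_bool (C = {})" by (rule rado_coeff_one)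
    show "rado_coeff (x \<otimes>\<^bsub>Q\<^esub> y) C = (\<Sum>D\<in>Pow C. rado_coeff x D * rado_coeff y (C - D))"
      if "x \<in> carrier Q" "y \<in> carrier Q" "clique rado_edge C" using that by (rule rado_coeff_mult)
    show "graded_ring Q Q_grading" by (rule graded_Q)
    show "x \<in> Q_grading n \<longleftrightarrow> x \<in> carrier Q \<and> (\<forall>C. rado_coeff x C \<noteq> 0 \<longrightarrow> int (set_encode C) = n)"
      by (rule Q_grading_iff)
  qed
qed

theorem theorem1p18:
  shows "totally_incoherent Q Q_grading
    \<and> \<not> graded_noetherian Q Q_grading
    \<and> double_annihilator_condition Q Q_grading
    \<and> \<not> self_injective TYPE('m::infinite) Q Q_grading
    \<and> graded_ring_iso (Q Quot nilradical Q) (quotient_grading Q Q_grading (nilradical Q))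
        field_two field_two_grading \<noteq> {}"
proof -
  interpret clique_algebra Q Q_grading rado_edge rado_coeff by (rule rado_clique_algebra)
  show ?thesis
    using totally_incoherent not_noetherian double_annihilator not_self_injective reduced_quotient
    by blast
qed

end
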